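(* Let $\Omega\subset\mathbb R^d$ be a connected open set, with flat Euclidean connection $\nabla^E$. Let $\Gamma_1,\Gamma_2$ be smooth symmetric $(1,2)$-tensor fields on $\Omega$, let $A_1,A_2$ be the local midpoint maps of $\nabla^E+\Gamma_1$ and $\nabla^E+\Gamma_2$, and suppose that $A_1(P,Q)+A_2(P,Q)=P+Q$ on an open neighborhood of the diagonal $\Delta_\Omega$ of $\Omega\times\Omega$. Then: (1) $\Gamma_2=-\Gamma_1$ on $\Omega$; (2) $\mathcal E_{\Gamma_1}(x;h)=0$ for all $x\in\Omega$ and $h\in\mathbb R^d$, where for a smooth symmetric $(1,2)$-tensor field $\Gamma$ $$\mathcal E_\Gamma(x;h):=2\,\Gamma\bigl(h,(D_h\Gamma)(h,h)\bigr)+5\,(D_{\Gamma(h,h)}\Gamma)(h,h)-4\,(D_h\Gamma)\bigl(h,\Gamma(h,h)\bigr),$$ all tensors being evaluated at $x$.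
   Context: A symmetric $(1,2)$-tensor field $\Gamma$ assigns to each $x\in\Omega$ a symmetric bilinear map $\mathbb R^d\times\mathbb R^d\to\mathbb R^d$; $D_v\Gamma$ is its directional derivative in direction $v$. $(\nabla^E+\Gamma)_XY=\nabla^E_XY+\Gamma(X,Y)$. Local midpoint map: for a torsion-free connection $D=\nabla^E+\Gamma$ on $\Omega$, the map $(P,v)\mapsto(P,\mathrm{Exp}^D_P(v))$ is a diffeomorphism from an open neighborhood of $\Omega\times\{0\}$ onto an open neighborhood $W_D$ of $\Delta_\Omega$ in $\Omega\times\Omega$; on $W_D$ the local midpoint map is $M_D(P,Q)=\mathrm{Exp}^D_P\bigl(\tfrac12(\mathrm{Exp}^D_P)^{-1}(Q)\bigr)$, where $\mathrm{Exp}^D_P(v)=\gamma_v(1)$ for the $D$-geodesic $\gamma_v$ with $\gamma_v(0)=P$, $\dot\gamma_v(0)=v$. *)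

theory Defs
  imports "HOL-Analysis.Analysis"
begin

text \<open>The sets \<^term>\<open>S\<close> below are meant to be open, so that \<^term>\<open>at x\<close> and the
  two-sided derivatives are the right notions. A function is of class $C^{k+1}$ iff it is
  differentiable and each of its directional derivatives is of class $C^k$.\<close>

fun Ck_on :: "nat \<Rightarrow> 'a::real_normed_vector set \<Rightarrow> ('a \<Rightarrow> 'b::real_normed_vector) \<Rightarrow> bool" where
  "Ck_on 0 S f \<longleftrightarrow> continuous_on S f"
| "Ck_on (Suc k) S f \<longleftrightarrow>
     (\<forall>x\<in>S. f differentiable (at x)) \<and>
     (\<forall>v. Ck_on k S (\<lambda>x. frechet_derivative f (at x) v))"

definition smooth_on :: "'a::real_normed_vector set \<Rightarrow> ('a \<Rightarrow> 'b::real_normed_vector) \<Rightarrow> bool" where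
  "smooth_on S f \<longleftrightarrow> (\<forall>k. Ck_on k S f)"

definition diffeomorphism_on ::
  "'a::real_normed_vector set \<Rightarrow> 'b::real_normed_vector set \<Rightarrow> ('a \<Rightarrow> 'b) \<Rightarrow> bool" where
  "diffeomorphism_on U W F \<longleftrightarrow>
     bij_betw F U W \<and> smooth_on U F \<and> smooth_on W (inv_into U F)"

type_synonym 'a tensor12 = "'a \<Rightarrow> 'a \<Rightarrow> 'a \<Rightarrow> 'a"

text \<open>\<^term>\<open>\<Gamma> x u v\<close> stands for $\Gamma_x(u,v)$; values at points outside
  \<^term>\<open>\<Omega>\<close> are irrelevant. Since each \<^term>\<open>\<Gamma> x\<close> is bilinear on a finite-dimensional space,
  smoothness of all the functions $x \mapsto \Gamma_x(u,v)$ amounts to smoothness of all components.\<close>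

definition smooth_sym_tensor :: "'a::euclidean_space set \<Rightarrow> 'a tensor12 \<Rightarrow> bool" where
  "smooth_sym_tensor \<Omega> \<Gamma> \<longleftrightarrow>
     (\<forall>x\<in>\<Omega>. bilinear (\<Gamma> x) \<and> (\<forall>u v. \<Gamma> x u v = \<Gamma> x v u)) \<and>
     (\<forall>u v. smooth_on \<Omega> (\<lambda>x. \<Gamma> x u v))"

text \<open>\<^term>\<open>tensor_deriv \<Gamma> w x u v\<close> stands for $(D_w\Gamma)_x(u,v)$.\<close>

definition tensor_deriv :: "'a::euclidean_space tensor12 \<Rightarrow> 'a \<Rightarrow> 'a tensor12" where
  "tensor_deriv \<Gamma> w x u v = frechet_derivative (\<lambda>y. \<Gamma> y u v) (at x) w"

definition obstruction :: "'a::euclidean_space tensor12 \<Rightarrow> 'a \<Rightarrow> 'a \<Rightarrow> 'a" where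
  "obstruction \<Gamma> x h =
     2 *\<^sub>R \<Gamma> x h (tensor_deriv \<Gamma> h x h h)
     + 5 *\<^sub>R tensor_deriv \<Gamma> (\<Gamma> x h h) x h h
     - 4 *\<^sub>R tensor_deriv \<Gamma> h x h (\<Gamma> x h h)"

text \<open>Geodesics of $D = \nabla^E + \Gamma$ in \<^term>\<open>\<Omega>\<close>, with velocity field \<^term>\<open>\<gamma>'\<close>: for a
  vector field $Y$ along $\gamma$ one has $D_{\dot\gamma} Y = \dot Y + \Gamma_\gamma(\dot\gamma, Y)$,
  so $D_{\dot\gamma}\dot\gamma = 0$ reads as follows.\<close>

definition geodesic_on ::
  "'a::euclidean_space set \<Rightarrow> 'a tensor12 \<Rightarrow> real set \<Rightarrow> (real \<Rightarrow> 'a) \<Rightarrow> (real \<Rightarrow> 'a) \<Rightarrow> bool" where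
  "geodesic_on \<Omega> \<Gamma> J \<gamma> \<gamma>' \<longleftrightarrow>
     (\<forall>t\<in>J. \<gamma> t \<in> \<Omega> \<and> (\<gamma> has_vector_derivative \<gamma>' t) (at t) \<and>
        (\<exists>a. (\<gamma>' has_vector_derivative a) (at t) \<and> a + \<Gamma> (\<gamma> t) (\<gamma>' t) (\<gamma>' t) = 0))"

text \<open>\<^term>\<open>exp_rel \<Omega> \<Gamma> P v Q\<close>: the geodesic with initial point \<^term>\<open>P\<close> and initial velocity
  \<^term>\<open>v\<close> exists in \<^term>\<open>\<Omega>\<close> at least up to time 1, and is at \<^term>\<open>Q\<close> at that time. By uniqueness
  for the geodesic equation there is at most one such \<^term>\<open>Q\<close> when \<^term>\<open>\<Gamma>\<close> is smooth, but
  there may be none, so \<open>geod_exp\<close> is meaningful only on \<open>exp_dom\<close>.\<close>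

definition exp_rel :: "'a::euclidean_space set \<Rightarrow> 'a tensor12 \<Rightarrow> 'a \<Rightarrow> 'a \<Rightarrow> 'a \<Rightarrow> bool" where
  "exp_rel \<Omega> \<Gamma> P v Q \<longleftrightarrow>
     (\<exists>J \<gamma> \<gamma>'. open J \<and> is_interval J \<and> {0..1} \<subseteq> J \<and> geodesic_on \<Omega> \<Gamma> J \<gamma> \<gamma>' \<and>
        \<gamma> 0 = P \<and> \<gamma>' 0 = v \<and> \<gamma> 1 = Q)"

definition exp_dom :: "'a::euclidean_space set \<Rightarrow> 'a tensor12 \<Rightarrow> ('a \<times> 'a) set" where
  "exp_dom \<Omega> \<Gamma> = {(P, v). \<exists>Q. exp_rel \<Omega> \<Gamma> P v Q}"

definition geod_exp :: "'a::euclidean_space set \<Rightarrow> 'a tensor12 \<Rightarrow> 'a \<Rightarrow> 'a \<Rightarrow> 'a" where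
  "geod_exp \<Omega> \<Gamma> P v = (THE Q. exp_rel \<Omega> \<Gamma> P v Q)"

definition diag :: "'a set \<Rightarrow> ('a \<times> 'a) set" where
  "diag \<Omega> = {(x, x) | x. x \<in> \<Omega>}"

text \<open>The local midpoint map depends on the choice of an open neighbourhood \<^term>\<open>U\<close> of the zero
  section, with image \<^term>\<open>W\<close>, on which $(P,v) \mapsto (P,\mathrm{Exp}_P(v))$ is a diffeomorphism;
  $\mathrm{Exp}_P^{-1}$ is the inverse of $\mathrm{Exp}_P$ on the fibre of \<^term>\<open>U\<close> over \<^term>\<open>P\<close>.
  Any two choices give the same map near the diagonal. Thus \<^term>\<open>local_midpoint_map \<Omega> \<Gamma> W M\<close>
  says that \<^term>\<open>M\<close>, restricted to \<^term>\<open>W\<close>, is the map obtained from some such choice with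
  image \<^term>\<open>W\<close>.\<close>

definition local_midpoint_map ::
  "'a::euclidean_space set \<Rightarrow> 'a tensor12 \<Rightarrow> ('a \<times> 'a) set \<Rightarrow> ('a \<Rightarrow> 'a \<Rightarrow> 'a) \<Rightarrow> bool" where
  "local_midpoint_map \<Omega> \<Gamma> W M \<longleftrightarrow>
     open W \<and> diag \<Omega> \<subseteq> W \<and> W \<subseteq> \<Omega> \<times> \<Omega> \<and>
     (\<exists>U. open U \<and> \<Omega> \<times> {0} \<subseteq> U \<and> U \<subseteq> exp_dom \<Omega> \<Gamma> \<and>
        diffeomorphism_on U W (\<lambda>(P, v). (P, geod_exp \<Omega> \<Gamma> P v)) \<and>
        (\<forall>(P, Q) \<in> W. M P Q =
           geod_exp \<Omega> \<Gamma> P ((1/2) *\<^sub>R inv_into {v. (P, v) \<in> U} (geod_exp \<Omega> \<Gamma> P) Q)))"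

end

theory Submission imports Defs begin

text \<open>Fix \<open>m \<in> \<Omega>\<close> and \<open>h\<close>, and let \<open>\<alpha>\<close> be the geodesic of the first connection with \<open>\<alpha>(0) = m\<close> and
  \<open>\<alpha>'(0) = h\<close>. For small \<open>s > 0\<close> put \<open>P = \<alpha>(-s)\<close> and \<open>Q = \<alpha>(s)\<close>, so that \<open>A1(P,Q) = m\<close>. The second midpoint
  map comes from a geodesic \<open>\<beta>\<close> of the second connection, parametrized by \<open>[-s,s]\<close>, with the same endpoints
  \<open>P\<close> and \<open>Q\<close> and with \<open>\<beta>(0) = A2(P,Q)\<close>. Choosing the chord symmetric about \<open>m\<close> keeps all expansions even or
  odd in \<open>s\<close>, and the whole hypothesis is contained in the three equations
  \<open>\<beta>(s) = \<alpha>(s)\<close>, \<open>\<beta>(-s) = \<alpha>(-s)\<close> and \<open>\<alpha>(0) + \<beta>(0) = \<alpha>(s) + \<alpha>(-s)\<close>.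

  Let \<open>\<sigma> = \<alpha> + \<beta>\<close>. Then \<open>\<sigma>(s) + \<sigma>(-s) - 2\<sigma>(0) = 0\<close>. At order \<open>s\<^sup>2\<close> this says that the accelerations
  \<open>-\<Gamma>1(h,h)\<close> and \<open>-\<Gamma>2(h,h)\<close> cancel, and polarization gives the first claim. At order \<open>s\<^sup>4\<close> it says that
  \<open>\<sigma>''(0) + s\<^sup>2 \<sigma>''''(0)/12\<close> is \<open>o(s\<^sup>2)\<close>. As \<open>\<Gamma>2 = -\<Gamma>1\<close>, the value \<open>\<sigma>''(0)\<close> is the variation of
  \<open>\<Gamma>1\<^sub>x(v,v)\<close> between \<open>(\<alpha>(0),\<alpha>'(0))\<close> and \<open>(\<beta>(0),\<beta>'(0))\<close>. These points differ by terms of order \<open>s\<^sup>2\<close>, which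
  are read off from \<open>\<beta> - \<alpha> = 0\<close> at both ends; the result is an identity quadratic in \<open>\<Gamma>1\<close>, namely the
  vanishing of the obstruction. The expansions are in \<open>matched_families_limits\<close> and the final
  computation in \<open>obstruction_of_matched_families\<close>.

  The curves \<open>\<beta>\<close> depend on \<open>s\<close>, so these expansions need \<open>\<beta>\<close> and \<open>\<beta>'\<close> to converge uniformly on \<open>[-s,s]\<close>
  to \<open>m\<close> and \<open>h\<close>. That is \<open>geodesic_family_through_chords\<close>, where the differentiability of the exponential map
  and of its inverse enters. Uniqueness of geodesics, \<open>geodesic_unique\<close>, makes the exponential map well defined
  and allows it to be evaluated along a given geodesic.\<close>

section \<open>Smooth symmetric tensor fields\<close>

lemma bilinear_basis_expansion:
  fixes B :: "'a::euclidean_space \<Rightarrow> 'a \<Rightarrow> 'c::real_vector"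
  assumes "bilinear B"
  shows "B u v = (\<Sum>i\<in>Basis. \<Sum>j\<in>Basis. ((u \<bullet> i) * (v \<bullet> j)) *\<^sub>R B i j)"
proof -
  have l1: "linear (\<lambda>x. B x y)" and l2: "linear (B x)" for x y
    using assms by (auto simp: bilinear_def)
  have "B u v = B (\<Sum>i\<in>Basis. (u \<bullet> i) *\<^sub>R i) v"
    by (simp add: euclidean_representation)
  also have "\<dots> = (\<Sum>i\<in>Basis. (u \<bullet> i) *\<^sub>R B i v)"
    by (simp add: linear_sum[OF l1] linear_cmul[OF l1])
  also have "\<dots> = (\<Sum>i\<in>Basis. (u \<bullet> i) *\<^sub>R B i (\<Sum>j\<in>Basis. (v \<bullet> j) *\<^sub>R j))"
    by (simp add: euclidean_representation)
  also have "\<dots> = (\<Sum>i\<in>Basis. (u \<bullet> i) *\<^sub>R (\<Sum>j\<in>Basis. (v \<bullet> j) *\<^sub>R B i j))"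
    by (simp add: linear_sum[OF l2] linear_cmul[OF l2])
  finally show ?thesis
    by (simp add: scaleR_sum_right)
qed

lemma smooth_sym_tensor_bilinear:
  "smooth_sym_tensor \<Omega> T \<Longrightarrow> x \<in> \<Omega> \<Longrightarrow> bilinear (T x)"
  and smooth_sym_tensor_sym:
  "smooth_sym_tensor \<Omega> T \<Longrightarrow> x \<in> \<Omega> \<Longrightarrow> T x u v = T x v u"
  by (auto simp: smooth_sym_tensor_def)

lemma smooth_sym_tensor_has_derivative:
  assumes "smooth_sym_tensor \<Omega> T" "x \<in> \<Omega>"
  shows "((\<lambda>y. T y u v) has_derivative (\<lambda>w. tensor_deriv T w x u v)) (at x)"
proof -
  have "Ck_on (Suc 0) \<Omega> (\<lambda>y. T y u v)"
    using assms(1) by (auto simp: smooth_sym_tensor_def smooth_on_def)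
  then have "(\<lambda>y. T y u v) differentiable (at x)"
    using assms(2) by simp
  then show ?thesis
    unfolding tensor_deriv_def by (simp add: frechet_derivative_works)
qed

lemma smooth_sym_tensor_linear_deriv:
  assumes "smooth_sym_tensor \<Omega> T" "x \<in> \<Omega>"
  shows "linear (\<lambda>w. tensor_deriv T w x u v)"
  using smooth_sym_tensor_has_derivative[OF assms] has_derivative_linear by blast

text \<open>Every identity between tensor fields that holds on an open set can be differentiated there; the
  bilinearity, symmetry and sign rules for \<^const>\<open>tensor_deriv\<close> all come from this.\<close>

lemma tensor_deriv_eqI:
  assumes "open \<Omega>" "x \<in> \<Omega>" "\<And>y. y \<in> \<Omega> \<Longrightarrow> T y u v = f y"
    and "(f has_derivative f') (at x)"
  shows "tensor_deriv T w x u v = f' w"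
proof -
  have "((\<lambda>y. T y u v) has_derivative f') (at x)"
    using has_derivative_transform_within_open[OF assms(4,1,2)] assms(3) by metis
  then show ?thesis
    unfolding tensor_deriv_def by (metis frechet_derivative_at)
qed

lemma smooth_sym_tensor_tensor_deriv:
  assumes "open \<Omega>" and T: "smooth_sym_tensor \<Omega> T"
  shows "smooth_sym_tensor \<Omega> (tensor_deriv T w)"
  unfolding smooth_sym_tensor_def
proof (intro conjI ballI allI)
  fix x u v assume x: "x \<in> \<Omega>"
  note D = smooth_sym_tensor_has_derivative[OF T x]
  note eqI = tensor_deriv_eqI[OF assms(1) x]
  have lin1: "linear (\<lambda>u. T y u v)" and lin2: "linear (T y u)" if "y \<in> \<Omega>" for y u v
    using smooth_sym_tensor_bilinear[OF T that] by (auto simp: bilinear_def)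
  show "tensor_deriv T w x u v = tensor_deriv T w x v u"
    by (rule eqI[OF _ D]) (simp add: smooth_sym_tensor_sym[OF T])
  show "bilinear (tensor_deriv T w x)"
    unfolding bilinear_def
  proof (intro conjI allI linearI)
    fix u v v' :: 'a and r :: real
    show "tensor_deriv T w x u (v + v') = tensor_deriv T w x u v + tensor_deriv T w x u v'"
      by (rule eqI[OF _ has_derivative_add[OF D D]]) (simp add: linear_add[OF lin2])
    show "tensor_deriv T w x (v + v') u = tensor_deriv T w x v u + tensor_deriv T w x v' u"
      by (rule eqI[OF _ has_derivative_add[OF D D]]) (simp add: linear_add[OF lin1])
    show "tensor_deriv T w x u (r *\<^sub>R v) = r *\<^sub>R tensor_deriv T w x u v"
      by (rule eqI[OF _ has_derivative_scaleR_right[OF D]]) (simp add: linear_cmul[OF lin2])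
    show "tensor_deriv T w x (r *\<^sub>R v) u = r *\<^sub>R tensor_deriv T w x v u"
      by (rule eqI[OF _ has_derivative_scaleR_right[OF D]]) (simp add: linear_cmul[OF lin1])
  qed
next
  fix u v
  have "Ck_on (Suc k) \<Omega> (\<lambda>y. T y u v)" for k
    using T by (auto simp: smooth_sym_tensor_def smooth_on_def)
  then show "smooth_on \<Omega> (\<lambda>x. tensor_deriv T w x u v)"
    unfolding smooth_on_def tensor_deriv_def by simp
qed

text \<open>Smoothness is assumed only of the functions \<open>x \<mapsto> T\<^sub>x(u,v)\<close> with \<open>u\<close>, \<open>v\<close> fixed. Joint continuity, and
  below joint differentiability, follow because \<open>T\<^sub>x(u,v)\<close> is a finite sum of products of coordinates
  of \<open>u\<close> and \<open>v\<close> with such functions.\<close>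

lemma tensor_tendsto:
  assumes "open \<Omega>" and T: "smooth_sym_tensor \<Omega> T" and "x \<in> \<Omega>"
    and "(X \<longlongrightarrow> x) F" "(A \<longlongrightarrow> a) F" "(B \<longlongrightarrow> b) F"
  shows "((\<lambda>s. T (X s) (A s) (B s)) \<longlongrightarrow> T x a b) F"
proof -
  have ev: "\<forall>\<^sub>F s in F. X s \<in> \<Omega>"
    using topological_tendstoD[OF assms(4,1,3)] .
  have lim: "((\<lambda>s. T (X s) i j) \<longlongrightarrow> T x i j) F" for i j
    using isCont_tendsto_compose[OF has_derivative_continuous[OF
      smooth_sym_tensor_has_derivative[OF T assms(3)]] assms(4)] .
  have "((\<lambda>s. \<Sum>i\<in>Basis. \<Sum>j\<in>Basis. ((A s \<bullet> i) * (B s \<bullet> j)) *\<^sub>R T (X s) i j) \<longlongrightarrow>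
      (\<Sum>i\<in>Basis. \<Sum>j\<in>Basis. ((a \<bullet> i) * (b \<bullet> j)) *\<^sub>R T x i j)) F"
    by (intro tendsto_intros assms lim)
  then have "((\<lambda>s. \<Sum>i\<in>Basis. \<Sum>j\<in>Basis. ((A s \<bullet> i) * (B s \<bullet> j)) *\<^sub>R T (X s) i j) \<longlongrightarrow> T x a b) F"
    using bilinear_basis_expansion[OF smooth_sym_tensor_bilinear[OF T assms(3)], of a b] by simp
  then show ?thesis
  proof (rule Lim_transform_eventually)
    show "\<forall>\<^sub>F s in F. (\<Sum>i\<in>Basis. \<Sum>j\<in>Basis. ((A s \<bullet> i) * (B s \<bullet> j)) *\<^sub>R T (X s) i j)
        = T (X s) (A s) (B s)"
      using ev by eventually_elim
        (simp flip: bilinear_basis_expansion[OF smooth_sym_tensor_bilinear[OF T]])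
  qed
qed

lemma tensor_deriv_expansion:
  assumes "smooth_sym_tensor \<Omega> T" "x \<in> \<Omega>"
  shows "tensor_deriv T w x u v = (\<Sum>k\<in>Basis. (w \<bullet> k) *\<^sub>R tensor_deriv T k x u v)"
proof -
  note l = smooth_sym_tensor_linear_deriv[OF assms, of u v]
  have "tensor_deriv T w x u v = tensor_deriv T (\<Sum>k\<in>Basis. (w \<bullet> k) *\<^sub>R k) x u v"
    by (simp add: euclidean_representation)
  then show ?thesis
    by (simp add: linear_sum[OF l] linear_cmul[OF l])
qed

lemma tensor_deriv_tendsto:
  assumes "open \<Omega>" and T: "smooth_sym_tensor \<Omega> T" and "x \<in> \<Omega>"
    and "(X \<longlongrightarrow> x) F" "(C \<longlongrightarrow> c) F" "(A \<longlongrightarrow> a) F" "(B \<longlongrightarrow> b) F"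
  shows "((\<lambda>s. tensor_deriv T (C s) (X s) (A s) (B s)) \<longlongrightarrow> tensor_deriv T c x a b) F"
proof -
  have ev: "\<forall>\<^sub>F s in F. X s \<in> \<Omega>"
    using topological_tendstoD[OF assms(4,1,3)] .
  note lim = tensor_tendsto[OF assms(1) smooth_sym_tensor_tensor_deriv[OF assms(1) T] assms(3,4,6,7)]
  have "((\<lambda>s. \<Sum>k\<in>Basis. (C s \<bullet> k) *\<^sub>R tensor_deriv T k (X s) (A s) (B s)) \<longlongrightarrow>
     (\<Sum>k\<in>Basis. (c \<bullet> k) *\<^sub>R tensor_deriv T k x a b)) F"
    by (intro tendsto_intros lim assms)
  then have "((\<lambda>s. \<Sum>k\<in>Basis. (C s \<bullet> k) *\<^sub>R tensor_deriv T k (X s) (A s) (B s)) \<longlongrightarrow>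
     tensor_deriv T c x a b) F"
    using tensor_deriv_expansion[OF T assms(3), of c a b] by simp
  then show ?thesis
  proof (rule Lim_transform_eventually)
    show "\<forall>\<^sub>F s in F. (\<Sum>k\<in>Basis. (C s \<bullet> k) *\<^sub>R tensor_deriv T k (X s) (A s) (B s)) =
        tensor_deriv T (C s) (X s) (A s) (B s)"
      using ev by eventually_elim (simp flip: tensor_deriv_expansion[OF T])
  qed
qed

lemma tensor_has_derivative:
  fixes c a b :: "'b::real_normed_vector \<Rightarrow> 'a::euclidean_space"
  assumes "open \<Omega>" and T: "smooth_sym_tensor \<Omega> T" and "c z \<in> \<Omega>"
    and c: "(c has_derivative c') (at z)" and a: "(a has_derivative a') (at z)"
    and b: "(b has_derivative b') (at z)"
  shows "((\<lambda>z. T (c z) (a z) (b z)) has_derivative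
    (\<lambda>k. tensor_deriv T (c' k) (c z) (a z) (b z) + T (c z) (a' k) (b z) + T (c z) (a z) (b' k))) (at z)"
proof -
  have ev: "\<forall>\<^sub>F y in at z. c y \<in> \<Omega>"
    using topological_tendstoD[OF has_derivative_continuous[OF c, unfolded isCont_def] assms(1,3)] .
  have Tc: "((\<lambda>y. T (c y) i j) has_derivative (\<lambda>k. tensor_deriv T (c' k) (c z) i j)) (at z)" for i j
    using has_derivative_compose[OF c smooth_sym_tensor_has_derivative[OF T assms(3)]] .
  note B1 = smooth_sym_tensor_bilinear[OF T assms(3)]
  note B2 = smooth_sym_tensor_bilinear[OF smooth_sym_tensor_tensor_deriv[OF assms(1) T] assms(3)]
  have "((\<lambda>y. \<Sum>i\<in>Basis. \<Sum>j\<in>Basis. ((a y \<bullet> i) * (b y \<bullet> j)) *\<^sub>R T (c y) i j) has_derivative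
     (\<lambda>k. \<Sum>i\<in>Basis. \<Sum>j\<in>Basis. ((a z \<bullet> i) * (b z \<bullet> j)) *\<^sub>R tensor_deriv T (c' k) (c z) i j
       + ((a z \<bullet> i) * (b' k \<bullet> j) + (a' k \<bullet> i) * (b z \<bullet> j)) *\<^sub>R T (c z) i j)) (at z)"
    by (intro has_derivative_sum has_derivative_scaleR has_derivative_mult
        has_derivative_inner_left a b Tc)
  also have "(\<lambda>k. \<Sum>i\<in>Basis. \<Sum>j\<in>Basis. ((a z \<bullet> i) * (b z \<bullet> j)) *\<^sub>R tensor_deriv T (c' k) (c z) i j
       + ((a z \<bullet> i) * (b' k \<bullet> j) + (a' k \<bullet> i) * (b z \<bullet> j)) *\<^sub>R T (c z) i j) =
     (\<lambda>k. tensor_deriv T (c' k) (c z) (a z) (b z) + T (c z) (a' k) (b z) + T (c z) (a z) (b' k))"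
    unfolding bilinear_basis_expansion[OF B1, of "a' _"] bilinear_basis_expansion[OF B1, of "a z"]
      bilinear_basis_expansion[OF B2, of _ "a z"]
    by (simp add: sum.distrib algebra_simps)
  finally have D: "((\<lambda>y. \<Sum>i\<in>Basis. \<Sum>j\<in>Basis. ((a y \<bullet> i) * (b y \<bullet> j)) *\<^sub>R T (c y) i j) has_derivative
     (\<lambda>k. tensor_deriv T (c' k) (c z) (a z) (b z) + T (c z) (a' k) (b z) + T (c z) (a z) (b' k))) (at z)" .
  have eq: "(\<Sum>i\<in>Basis. \<Sum>j\<in>Basis. ((a y \<bullet> i) * (b y \<bullet> j)) *\<^sub>R T (c y) i j) = T (c y) (a y) (b y)"
    if "c y \<in> \<Omega>" for y
    using bilinear_basis_expansion[OF smooth_sym_tensor_bilinear[OF T that], of "a y" "b y"] by simp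
  show ?thesis
    by (rule has_derivative_transform_eventually[OF D]) (use ev eq assms(3) in \<open>auto elim: eventually_mono\<close>)
qed

lemma tensor_has_vector_derivative:
  fixes c a b :: "real \<Rightarrow> 'a::euclidean_space"
  assumes "open \<Omega>" and T: "smooth_sym_tensor \<Omega> T" and "c t \<in> \<Omega>"
    and "(c has_vector_derivative c') (at t)" "(a has_vector_derivative a') (at t)"
    and "(b has_vector_derivative b') (at t)"
  shows "((\<lambda>t. T (c t) (a t) (b t)) has_vector_derivative
    tensor_deriv T c' (c t) (a t) (b t) + T (c t) a' (b t) + T (c t) (a t) b') (at t)"
proof -
  have lin: "linear (\<lambda>u. T (c t) u v)" "linear (T (c t) u)" for u v
    using smooth_sym_tensor_bilinear[OF T assms(3)] by (auto simp: bilinear_def)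
  show ?thesis
    using tensor_has_derivative[OF assms(1,2), of c t, OF assms(3)
      assms(4-6)[unfolded has_vector_derivative_def]]
    by (simp add: has_vector_derivative_def linear_cmul[OF lin(1)] linear_cmul[OF lin(2)]
        linear_cmul[OF smooth_sym_tensor_linear_deriv[OF T assms(3)]] scaleR_add_right)
qed

section \<open>Uniqueness of geodesics and the exponential map\<close>

lemma vector_derivative_norm_bound:
  fixes g :: "real \<Rightarrow> 'a::real_normed_vector"
  assumes "convex S" "a \<in> S" "b \<in> S"
    and "\<And>t. t \<in> S \<Longrightarrow> (g has_vector_derivative g' t) (at t)"
    and "\<And>t. t \<in> S \<Longrightarrow> norm (g' t) \<le> B"
  shows "norm (g b - g a) \<le> B * \<bar>b - a\<bar>"
proof -
  have "norm (g b - g a) \<le> B * norm (b - a)"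
  proof (rule differentiable_bound[OF assms(1) _ _ assms(3,2)])
    fix t assume "t \<in> S"
    show "(g has_derivative (\<lambda>h. h *\<^sub>R g' t)) (at t within S)"
      using assms(4)[OF \<open>t \<in> S\<close>] has_derivative_at_withinI
      unfolding has_vector_derivative_def by blast
    show "onorm (\<lambda>h. h *\<^sub>R g' t) \<le> B"
    proof (rule onorm_le)
      fix h :: real
      show "norm (h *\<^sub>R g' t) \<le> B * norm h"
        using mult_right_mono[OF assms(5)[OF \<open>t \<in> S\<close>], of "\<bar>h\<bar>"] by (simp add: mult.commute)
    qed
  qed
  then show ?thesis by simp
qed

text \<open>Two solutions that agree at \<open>t\<close> agree nearby: if \<open>D\<close> is their largest distance at
  times within \<open>\<delta>\<close> of \<open>t\<close>, the mean value inequality gives \<open>D \<le> L * D * \<delta>\<close>. Hence the set of times at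
  which they agree is open and closed.\<close>

lemma autonomous_ode_unique:
  fixes f :: "'b::real_normed_vector \<Rightarrow> 'b" and Y Z :: "real \<Rightarrow> 'b"
  assumes lip: "local_lipschitz (UNIV::real set) X (\<lambda>_. f)"
    and J: "open J" "is_interval J"
    and Y: "\<And>t. t \<in> J \<Longrightarrow> Y t \<in> X" "\<And>t. t \<in> J \<Longrightarrow> (Y has_vector_derivative f (Y t)) (at t)"
    and Z: "\<And>t. t \<in> J \<Longrightarrow> Z t \<in> X" "\<And>t. t \<in> J \<Longrightarrow> (Z has_vector_derivative f (Z t)) (at t)"
    and t0: "t0 \<in> J" "Y t0 = Z t0" and "t \<in> J"
  shows "Y t = Z t"
proof -
  define A where "A = {t \<in> J. Y t - Z t = 0}"
  have contYZ: "continuous_on J Y" "continuous_on J Z"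
    using Y(2) Z(2) by (auto intro!: continuous_at_imp_continuous_on has_vector_derivative_continuous)
  have closed: "closedin (top_of_set J) A"
    unfolding A_def
    by (intro continuous_closedin_preimage_constant continuous_intros contYZ)
  have "open A"
    unfolding open_dist
  proof
    fix s assume "s \<in> A"
    then have s: "s \<in> J" "Y s = Z s" by (auto simp: A_def)
    obtain u L where u: "u > 0" and L: "L-lipschitz_on (cball (Y s) u \<inter> X) f"
      using lip Y(1)[OF s(1)] unfolding local_lipschitz_def by (metis IntI UNIV_I centre_in_cball less_imp_le)
    have L0: "0 \<le> L" using lipschitz_on_nonneg[OF L] .
    have ev: "\<forall>\<^sub>F \<tau> in nhds s. \<tau> \<in> J \<and> dist (Y \<tau>) (Y s) < u \<and> dist (Z \<tau>) (Y s) < u"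
    proof (intro eventually_conj)
      show "\<forall>\<^sub>F \<tau> in nhds s. \<tau> \<in> J" using J(1) s(1) by (rule eventually_nhds_in_open)
      have "isCont Y s" "isCont Z s"
        using Y(2) Z(2) s(1) has_vector_derivative_continuous by blast+
      then have "(Y \<longlongrightarrow> Y s) (nhds s)" "(Z \<longlongrightarrow> Z s) (nhds s)"
        unfolding isCont_def tendsto_at_iff_tendsto_nhds .
      then have "(Y \<longlongrightarrow> Y s) (nhds s)" "(Z \<longlongrightarrow> Y s) (nhds s)"
        by (simp_all add: s(2))
      then show "\<forall>\<^sub>F \<tau> in nhds s. dist (Y \<tau>) (Y s) < u" "\<forall>\<^sub>F \<tau> in nhds s. dist (Z \<tau>) (Y s) < u"
        using u tendstoD by blast+
    qed
    then obtain d where d: "d > 0"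
      "\<And>\<tau>. dist \<tau> s < d \<Longrightarrow> \<tau> \<in> J \<and> dist (Y \<tau>) (Y s) < u \<and> dist (Z \<tau>) (Y s) < u"
      unfolding eventually_nhds_metric by auto
    \<comment> \<open>The bound \<open>L\<delta> \<le> 1/2\<close> makes the mean value estimate below a contraction, also when \<open>L = 0\<close>.\<close>
    define \<delta> where "\<delta> = min (d / 2) (1 / (2 * (L + 1)))"
    have \<delta>: "0 < \<delta>" "\<delta> < d" "L * \<delta> \<le> 1 / 2"
    proof -
      show "0 < \<delta>" "\<delta> < d" using d(1) L0 by (auto simp: \<delta>_def min_less_iff_disj)
      have "L * \<delta> \<le> L * (1 / (2 * (L + 1)))"
        using L0 by (intro mult_left_mono) (auto simp: \<delta>_def)
      also have "\<dots> \<le> 1 / 2" using L0 by (simp add: field_simps)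
      finally show "L * \<delta> \<le> 1 / 2" .
    qed
    define I where "I = {s - \<delta>..s + \<delta>}"
    have I: "dist \<tau> s < d" if "\<tau> \<in> I" for \<tau>
      using that \<delta> by (auto simp: I_def dist_real_def)
    have IJ: "I \<subseteq> J" using I d(2) by auto
    have "continuous_on I (\<lambda>\<tau>. norm (Y \<tau> - Z \<tau>))"
      by (intro continuous_intros continuous_on_subset[OF _ IJ] contYZ)
    then obtain m where m: "m \<in> I" "\<And>\<tau>. \<tau> \<in> I \<Longrightarrow> norm (Y \<tau> - Z \<tau>) \<le> norm (Y m - Z m)"
      using continuous_attains_sup[of I] \<delta>(1) unfolding I_def by force
    let ?D = "norm (Y m - Z m)"
    have "norm ((Y m - Z m) - (Y s - Z s)) \<le> (L * ?D) * \<bar>m - s\<bar>"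
    proof (rule vector_derivative_norm_bound[where S = I])
      show "convex I" "m \<in> I" "s \<in> I" using \<delta> m by (auto simp: I_def)
      fix \<tau> assume \<tau>: "\<tau> \<in> I"
      note dd = d(2)[OF I[OF \<tau>]]
      show "((\<lambda>t. Y t - Z t) has_vector_derivative f (Y \<tau>) - f (Z \<tau>)) (at \<tau>)"
        using dd by (intro has_vector_derivative_diff Y Z) auto
      have "norm (f (Y \<tau>) - f (Z \<tau>)) \<le> L * norm (Y \<tau> - Z \<tau>)"
        using lipschitz_onD[OF L, of "Y \<tau>" "Z \<tau>"] dd Y(1) Z(1)
        by (auto simp: dist_norm norm_minus_commute)
      also have "\<dots> \<le> L * ?D" using L0 m(2)[OF \<tau>] by (intro mult_left_mono)
      finally show "norm (f (Y \<tau>) - f (Z \<tau>)) \<le> L * ?D" .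
    qed
    then have "?D \<le> (L * ?D) * \<bar>m - s\<bar>" using s(2) by simp
    also have "\<dots> \<le> (L * ?D) * \<delta>"
      using m(1) L0 by (intro mult_left_mono) (auto simp: I_def)
    also have "\<dots> = (L * \<delta>) * ?D" by simp
    also have "\<dots> \<le> 1 / 2 * ?D" using \<delta>(3) by (intro mult_right_mono) auto
    finally have D0: "?D \<le> 0" by simp
    show "\<exists>e>0. \<forall>\<tau>. dist \<tau> s < e \<longrightarrow> \<tau> \<in> A"
    proof (intro exI conjI allI impI)
      show "\<delta> > 0" using \<delta> by simp
      fix \<tau> assume "dist \<tau> s < \<delta>"
      then have "\<tau> \<in> I" by (auto simp: I_def dist_real_def)
      then show "\<tau> \<in> A" using m(2)[of \<tau>] D0 IJ by (auto simp: A_def)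
    qed
  qed
  then have "openin (top_of_set J) A" using open_subset[of A J] by (auto simp: A_def)
  moreover have "connected J" using J(2) by (simp add: is_interval_connected)
  ultimately have "A = {} \<or> A = J" using closed connected_clopen by blast
  then show ?thesis using t0 \<open>t \<in> J\<close> by (auto simp: A_def)
qed

text \<open>The right-hand side of the geodesic equation, written as a first-order system for \<open>(x,v)\<close>, is
  continuously differentiable.\<close>

lemma geodesic_field_local_lipschitz:
  fixes \<Gamma> :: "'a::euclidean_space tensor12"
  assumes "open \<Omega>" and T: "smooth_sym_tensor \<Omega> \<Gamma>"
  shows "local_lipschitz (UNIV::real set) (\<Omega> \<times> UNIV) (\<lambda>_ (x, v). (v, - \<Gamma> x v v))"
proof -
  define D where "D z k = (snd k, - (tensor_deriv \<Gamma> (fst k) (fst z) (snd z) (snd z) +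
     \<Gamma> (fst z) (snd k) (snd z) + \<Gamma> (fst z) (snd z) (snd k)))" for z k :: "'a \<times> 'a"
  have der: "((\<lambda>(x, v). (v, - \<Gamma> x v v)) has_derivative D z) (at z)" if "z \<in> \<Omega> \<times> UNIV" for z
  proof -
    have "fst z \<in> \<Omega>" using that by auto
    have "((\<lambda>z. (snd z, - \<Gamma> (fst z) (snd z) (snd z))) has_derivative D z) (at z)"
      unfolding D_def
      by (intro has_derivative_Pair has_derivative_minus tensor_has_derivative[OF assms, where c = fst] \<open>fst z \<in> \<Omega>\<close>
          bounded_linear_imp_has_derivative bounded_linear_fst bounded_linear_snd)
    then show ?thesis by (simp add: case_prod_unfold)
  qed
  have app: "blinfun_apply (Blinfun (D z)) = D z" if "z \<in> \<Omega> \<times> UNIV" for z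
    using der[OF that] has_derivative_bounded_linear bounded_linear_Blinfun_apply by blast
  show ?thesis
  proof (rule c1_implies_local_lipschitz[where f' = "\<lambda>(t, z). Blinfun (D z)"])
    show "open (\<Omega> \<times> (UNIV::'a set))" using assms(1) by (intro open_Times open_UNIV)
    show "continuous_on (UNIV \<times> \<Omega> \<times> UNIV) (\<lambda>(t::real, z). Blinfun (D z))"
    proof (rule continuous_on_blinfun_componentwise)
      fix k :: "'a \<times> 'a"
      have "continuous_on (UNIV \<times> \<Omega> \<times> UNIV) (\<lambda>p::real \<times> 'a \<times> 'a. D (snd p) k)"
        unfolding D_def continuous_on_def
      proof (intro ballI tendsto_intros tensor_tendsto[OF assms] tensor_deriv_tendsto[OF assms])
      qed auto
      then show "continuous_on (UNIV \<times> \<Omega> \<times> UNIV)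
          (\<lambda>x. blinfun_apply (case x of (t::real, z) \<Rightarrow> Blinfun (D z)) k)"
        by (rule continuous_on_eq) (auto simp: app)
    qed
  qed (use der app in auto)
qed

lemma geodesic_onD:
  assumes "geodesic_on \<Omega> \<Gamma> J \<gamma> \<gamma>'" "t \<in> J"
  shows "\<gamma> t \<in> \<Omega>" "(\<gamma> has_vector_derivative \<gamma>' t) (at t)"
    "(\<gamma>' has_vector_derivative - \<Gamma> (\<gamma> t) (\<gamma>' t) (\<gamma>' t)) (at t)"
  using assms by (auto simp: geodesic_on_def eq_neg_iff_add_eq_0[symmetric])

lemma geodesic_on_subset:
  "geodesic_on \<Omega> \<Gamma> J \<gamma> \<gamma>' \<Longrightarrow> I \<subseteq> J \<Longrightarrow> geodesic_on \<Omega> \<Gamma> I \<gamma> \<gamma>'"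
  unfolding geodesic_on_def by blast

lemma geodesic_unique:
  fixes \<Gamma> :: "'a::euclidean_space tensor12"
  assumes "open \<Omega>" "smooth_sym_tensor \<Omega> \<Gamma>" and J: "open J" "is_interval J"
    and 1: "geodesic_on \<Omega> \<Gamma> J \<gamma> \<gamma>'" and 2: "geodesic_on \<Omega> \<Gamma> J \<eta> \<eta>'"
    and "t0 \<in> J" "\<gamma> t0 = \<eta> t0" "\<gamma>' t0 = \<eta>' t0" "t \<in> J"
  shows "\<gamma> t = \<eta> t"
proof -
  let ?f = "\<lambda>(x, v). (v, - \<Gamma> x v v)"
  let ?Y = "\<lambda>t. (\<gamma> t, \<gamma>' t)" and ?Z = "\<lambda>t. (\<eta> t, \<eta>' t)"
  have "(?Y has_vector_derivative ?f (?Y s)) (at s)" "(?Z has_vector_derivative ?f (?Z s)) (at s)"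
    "?Y s \<in> \<Omega> \<times> UNIV" "?Z s \<in> \<Omega> \<times> UNIV" if "s \<in> J" for s
    using geodesic_onD[OF 1 that] geodesic_onD[OF 2 that]
    by (auto intro!: has_vector_derivative_Pair)
  then have "?Y t = ?Z t"
    using autonomous_ode_unique[OF geodesic_field_local_lipschitz[OF assms(1,2)] J, of ?Y ?Z t0 t]
      assms(7-) by blast
  then show ?thesis by simp
qed

lemma geodesic_on_affine:
  fixes \<Gamma> :: "'a::euclidean_space tensor12"
  assumes T: "smooth_sym_tensor \<Omega> \<Gamma>" and g: "geodesic_on \<Omega> \<Gamma> J \<gamma> \<gamma>'"
  shows "geodesic_on \<Omega> \<Gamma> {t. a + b * t \<in> J} (\<lambda>t. \<gamma> (a + b * t)) (\<lambda>t. b *\<^sub>R \<gamma>' (a + b * t))"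
  unfolding geodesic_on_def
proof (intro ballI conjI exI)
  fix t assume "t \<in> {t. a + b * t \<in> J}"
  then have t: "a + b * t \<in> J" by simp
  note G = geodesic_onD[OF g t]
  show "\<gamma> (a + b * t) \<in> \<Omega>" by fact
  have aff: "((\<lambda>t. a + b * t) has_vector_derivative b) (at t)"
    by (auto intro!: derivative_eq_intros)
  show "((\<lambda>t. \<gamma> (a + b * t)) has_vector_derivative b *\<^sub>R \<gamma>' (a + b * t)) (at t)"
    using vector_diff_chain_at[OF aff G(2)] by (simp add: o_def)
  show "((\<lambda>t. b *\<^sub>R \<gamma>' (a + b * t)) has_vector_derivative
     b *\<^sub>R (b *\<^sub>R - \<Gamma> (\<gamma> (a + b * t)) (\<gamma>' (a + b * t)) (\<gamma>' (a + b * t)))) (at t)"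
    using bounded_linear.has_vector_derivative[OF bounded_linear_scaleR_right
        vector_diff_chain_at[OF aff G(3)]] by (simp add: o_def)
  have lin: "linear (\<lambda>u. \<Gamma> (\<gamma> (a + b * t)) u v)" "linear (\<Gamma> (\<gamma> (a + b * t)) u)" for u v
    using smooth_sym_tensor_bilinear[OF T G(1)] by (auto simp: bilinear_def)
  show "b *\<^sub>R (b *\<^sub>R - \<Gamma> (\<gamma> (a + b * t)) (\<gamma>' (a + b * t)) (\<gamma>' (a + b * t))) +
     \<Gamma> (\<gamma> (a + b * t)) (b *\<^sub>R \<gamma>' (a + b * t)) (b *\<^sub>R \<gamma>' (a + b * t)) = 0"
    by (simp add: linear_cmul[OF lin(1)] linear_cmul[OF lin(2)])
qed

lemma exp_rel_unique:
  fixes \<Gamma> :: "'a::euclidean_space tensor12"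
  assumes "open \<Omega>" "smooth_sym_tensor \<Omega> \<Gamma>" "exp_rel \<Omega> \<Gamma> P v Q" "exp_rel \<Omega> \<Gamma> P v Q'"
  shows "Q = Q'"
proof -
  obtain J \<gamma> \<gamma>' where 1: "open J" "is_interval J" "{0..1} \<subseteq> J" "geodesic_on \<Omega> \<Gamma> J \<gamma> \<gamma>'"
    "\<gamma> 0 = P" "\<gamma>' 0 = v" "\<gamma> 1 = Q"
    using assms(3) unfolding exp_rel_def by blast
  obtain K \<eta> \<eta>' where 2: "open K" "is_interval K" "{0..1} \<subseteq> K" "geodesic_on \<Omega> \<Gamma> K \<eta> \<eta>'"
    "\<eta> 0 = P" "\<eta>' 0 = v" "\<eta> 1 = Q'"
    using assms(4) unfolding exp_rel_def by blast
  have J01: "0 \<in> J \<inter> K" "1 \<in> J \<inter> K" using 1(3) 2(3) by auto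
  have "\<gamma> 1 = \<eta> 1"
    by (rule geodesic_unique[OF assms(1,2), of "J \<inter> K" \<gamma> \<gamma>' \<eta> \<eta>' 0])
      (use 1 2 J01 in \<open>auto intro!: is_interval_Int open_Int elim: geodesic_on_subset\<close>)
  then show ?thesis using 1 2 by simp
qed

lemma geod_exp_eqI:
  assumes "open \<Omega>" "smooth_sym_tensor \<Omega> \<Gamma>" "exp_rel \<Omega> \<Gamma> P v Q"
  shows "geod_exp \<Omega> \<Gamma> P v = Q"
  unfolding geod_exp_def using exp_rel_unique[OF assms(1,2)] assms(3) by blast

text \<open>Any two times of one geodesic, and not only \<open>0\<close> and \<open>1\<close>, are related by the exponential map
  after an affine change of parameter.\<close>

lemma geod_exp_along_geodesic:
  fixes \<Gamma> :: "'a::euclidean_space tensor12"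
  assumes "open \<Omega>" and T: "smooth_sym_tensor \<Omega> \<Gamma>" and J: "open J" "is_interval J"
    and g: "geodesic_on \<Omega> \<Gamma> J \<gamma> \<gamma>'" and "p \<in> J" "q \<in> J"
  shows "geod_exp \<Omega> \<Gamma> (\<gamma> p) ((q - p) *\<^sub>R \<gamma>' p) = \<gamma> q"
proof (rule geod_exp_eqI[OF assms(1,2)])
  let ?I = "{t. p + (q - p) * t \<in> J}"
  have "open ((\<lambda>t. p + (q - p) * t) -` J)"
    by (intro continuous_open_vimage continuous_intros J(1))
  then have "open ?I" by (simp add: vimage_def)
  moreover have "is_interval ?I"
    unfolding is_interval_1
  proof (intro ballI allI impI; (elim conjE)?)
    fix a b x assume "a \<in> ?I" "b \<in> ?I" "a \<le> x" "x \<le> b"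
    moreover have "p + (q - p) * a \<le> p + (q - p) * x \<and> p + (q - p) * x \<le> p + (q - p) * b \<or>
        p + (q - p) * b \<le> p + (q - p) * x \<and> p + (q - p) * x \<le> p + (q - p) * a"
      using \<open>a \<le> x\<close> \<open>x \<le> b\<close>
      by (cases "q - p \<ge> 0") (auto intro: mult_left_mono mult_left_mono_neg)
    ultimately show "x \<in> ?I" using J(2) unfolding is_interval_1 by blast
  qed
  moreover have "{0..1} \<subseteq> ?I"
  proof
    fix t :: real assume t: "t \<in> {0..1}"
    have "p + (q - p) * t = (1 - t) *\<^sub>R p + t *\<^sub>R q" by (simp add: algebra_simps)
    also have "\<dots> \<in> J" using t convexD_alt[OF is_interval_convex[OF J(2)] assms(6,7)] by auto
    finally show "t \<in> ?I" by simp
  qed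
  ultimately show "exp_rel \<Omega> \<Gamma> (\<gamma> p) ((q - p) *\<^sub>R \<gamma>' p) (\<gamma> q)"
    unfolding exp_rel_def using geodesic_on_affine[OF T g, of p "q - p"]
    by (intro exI[of _ ?I] exI[of _ "\<lambda>t. \<gamma> (p + (q - p) * t)"]
        exI[of _ "\<lambda>t. (q - p) *\<^sub>R \<gamma>' (p + (q - p) * t)"]) auto
qed

section \<open>Higher derivatives of geodesics\<close>

text \<open>\<open>D\<^sub>w\<Gamma>\<close> is a tensor field only for a constant direction \<open>w\<close>. A direction that moves along the curve is
  expanded in the basis, which is where the sum over second derivatives comes from.\<close>

lemma tensor_deriv_has_vector_derivative:
  fixes c w a b :: "real \<Rightarrow> 'a::euclidean_space"
  assumes "open \<Omega>" and T: "smooth_sym_tensor \<Omega> T" and "c t \<in> \<Omega>"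
    and c: "(c has_vector_derivative c') (at t)" and w: "(w has_vector_derivative w') (at t)"
    and a: "(a has_vector_derivative a') (at t)" and b: "(b has_vector_derivative b') (at t)"
  shows "((\<lambda>t. tensor_deriv T (w t) (c t) (a t) (b t)) has_vector_derivative
    (\<Sum>k\<in>Basis. (w t \<bullet> k) *\<^sub>R tensor_deriv (tensor_deriv T k) c' (c t) (a t) (b t))
    + tensor_deriv T w' (c t) (a t) (b t) + tensor_deriv T (w t) (c t) a' (b t)
    + tensor_deriv T (w t) (c t) (a t) b') (at t)"
proof -
  have ev: "\<forall>\<^sub>F s in at t. c s \<in> \<Omega>"
    using topological_tendstoD[OF has_vector_derivative_continuous[OF c, unfolded isCont_def]
      assms(1,3)] .
  note ex = tensor_deriv_expansion[OF T assms(3)]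
  note D = tensor_has_vector_derivative[OF assms(1) smooth_sym_tensor_tensor_deriv[OF assms(1) T]
      assms(3) c a b]
  have wk: "((\<lambda>t. w t \<bullet> k) has_real_derivative w' \<bullet> k) (at t)" for k
    using bounded_linear.has_vector_derivative[OF bounded_linear_inner_left w]
    by (simp add: has_real_derivative_iff_has_vector_derivative)
  have "((\<lambda>t. \<Sum>k\<in>Basis. (w t \<bullet> k) *\<^sub>R tensor_deriv T k (c t) (a t) (b t)) has_vector_derivative
     (\<Sum>k\<in>Basis. (w t \<bullet> k) *\<^sub>R (tensor_deriv (tensor_deriv T k) c' (c t) (a t) (b t)
        + tensor_deriv T k (c t) a' (b t) + tensor_deriv T k (c t) (a t) b')
      + (w' \<bullet> k) *\<^sub>R tensor_deriv T k (c t) (a t) (b t))) (at t)"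
    by (intro has_vector_derivative_sum has_vector_derivative_scaleR D wk)
  also have "(\<Sum>k\<in>Basis. (w t \<bullet> k) *\<^sub>R (tensor_deriv (tensor_deriv T k) c' (c t) (a t) (b t)
        + tensor_deriv T k (c t) a' (b t) + tensor_deriv T k (c t) (a t) b')
      + (w' \<bullet> k) *\<^sub>R tensor_deriv T k (c t) (a t) (b t)) =
    (\<Sum>k\<in>Basis. (w t \<bullet> k) *\<^sub>R tensor_deriv (tensor_deriv T k) c' (c t) (a t) (b t))
    + tensor_deriv T w' (c t) (a t) (b t) + tensor_deriv T (w t) (c t) a' (b t)
    + tensor_deriv T (w t) (c t) (a t) b'"
    unfolding ex[of w'] ex[of "w t"] by (simp add: sum.distrib scaleR_add_right add_ac)
  finally have D': "((\<lambda>t. \<Sum>k\<in>Basis. (w t \<bullet> k) *\<^sub>R tensor_deriv T k (c t) (a t) (b t)) has_derivative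
     (\<lambda>h. h *\<^sub>R ((\<Sum>k\<in>Basis. (w t \<bullet> k) *\<^sub>R tensor_deriv (tensor_deriv T k) c' (c t) (a t) (b t))
    + tensor_deriv T w' (c t) (a t) (b t) + tensor_deriv T (w t) (c t) a' (b t)
    + tensor_deriv T (w t) (c t) (a t) b'))) (at t)"
    unfolding has_vector_derivative_def .
  show ?thesis
    unfolding has_vector_derivative_def
    by (rule has_derivative_transform_eventually[OF D'])
      (use ev tensor_deriv_expansion[OF T] assms(3) in \<open>auto elim: eventually_mono\<close>)
qed

text \<open>The second, third and fourth derivative of a geodesic as functions of its position \<open>x\<close> and velocity
  \<open>v\<close>. They are found by differentiating \<open>\<gamma>'' = -\<Gamma>\<^sub>\<gamma>(\<gamma>',\<gamma>')\<close> and eliminating the higher derivatives;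
  \<open>tensor_deriv2 \<Gamma> x v\<close> is \<open>(D\<^sub>v D\<^sub>v \<Gamma>)\<^sub>x(v,v)\<close>.\<close>

definition geod_acc :: "'a::euclidean_space tensor12 \<Rightarrow> 'a \<Rightarrow> 'a \<Rightarrow> 'a" where
  "geod_acc \<Gamma> x v = - \<Gamma> x v v"

definition geod_jerk :: "'a::euclidean_space tensor12 \<Rightarrow> 'a \<Rightarrow> 'a \<Rightarrow> 'a" where
  "geod_jerk \<Gamma> x v = - tensor_deriv \<Gamma> v x v v - 2 *\<^sub>R \<Gamma> x v (geod_acc \<Gamma> x v)"

definition tensor_deriv2 :: "'a::euclidean_space tensor12 \<Rightarrow> 'a \<Rightarrow> 'a \<Rightarrow> 'a" where
  "tensor_deriv2 \<Gamma> x v = (\<Sum>k\<in>Basis. (v \<bullet> k) *\<^sub>R tensor_deriv (tensor_deriv \<Gamma> k) v x v v)"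

definition geod_snap :: "'a::euclidean_space tensor12 \<Rightarrow> 'a \<Rightarrow> 'a \<Rightarrow> 'a" where
  "geod_snap \<Gamma> x v = - tensor_deriv2 \<Gamma> x v - tensor_deriv \<Gamma> (geod_acc \<Gamma> x v) x v v
     - 4 *\<^sub>R tensor_deriv \<Gamma> v x v (geod_acc \<Gamma> x v)
     - 2 *\<^sub>R \<Gamma> x (geod_acc \<Gamma> x v) (geod_acc \<Gamma> x v) - 2 *\<^sub>R \<Gamma> x v (geod_jerk \<Gamma> x v)"

definition geod_jet :: "'a::euclidean_space tensor12 \<Rightarrow> nat \<Rightarrow> 'a \<Rightarrow> 'a \<Rightarrow> 'a" where
  "geod_jet \<Gamma> k x v = [x, v, geod_acc \<Gamma> x v, geod_jerk \<Gamma> x v, geod_snap \<Gamma> x v] ! k"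

lemma geod_jet_simps [simp]:
  "geod_jet \<Gamma> 0 x v = x" "geod_jet \<Gamma> (Suc 0) x v = v" "geod_jet \<Gamma> 2 x v = geod_acc \<Gamma> x v"
  "geod_jet \<Gamma> 3 x v = geod_jerk \<Gamma> x v" "geod_jet \<Gamma> 4 x v = geod_snap \<Gamma> x v"
  by (simp_all add: geod_jet_def)

lemma less_4_cases: "k < (4::nat) \<Longrightarrow> k = 0 \<or> k = Suc 0 \<or> k = 2 \<or> k = 3"
  by auto

lemma geod_jet_has_vector_derivative:
  assumes "open \<Omega>" and T: "smooth_sym_tensor \<Omega> \<Gamma>"
    and g: "geodesic_on \<Omega> \<Gamma> J \<gamma> \<gamma>'" "t \<in> J" and "k < 4"
  shows "((\<lambda>t. geod_jet \<Gamma> k (\<gamma> t) (\<gamma>' t)) has_vector_derivative geod_jet \<Gamma> (Suc k) (\<gamma> t) (\<gamma>' t)) (at t)"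
proof -
  note G = geodesic_onD[OF g]
  let ?x = "\<gamma> t" and ?v = "\<gamma>' t"
  let ?a = "geod_acc \<Gamma> ?x ?v" and ?j = "geod_jerk \<Gamma> ?x ?v"
  have 1: "(\<gamma>' has_vector_derivative ?a) (at t)"
    using G(3) by (simp add: geod_acc_def)
  note sym = smooth_sym_tensor_sym[OF T G(1)]
    smooth_sym_tensor_sym[OF smooth_sym_tensor_tensor_deriv[OF assms(1) T] G(1)]
  have s1: "\<Gamma> ?x ?a ?v = \<Gamma> ?x ?v ?a"
    by (rule sym(1))
  have 2: "((\<lambda>t. geod_acc \<Gamma> (\<gamma> t) (\<gamma>' t)) has_vector_derivative ?j) (at t)"
    unfolding geod_acc_def[of _ "\<gamma> _"]
    by (rule has_vector_derivative_eq_rhs[OF has_vector_derivative_minus[OF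
          tensor_has_vector_derivative[OF assms(1) T, where t = t, OF G(1,2) 1 1]]])
      (simp add: geod_jerk_def s1 scaleR_2)
  have s2: "tensor_deriv \<Gamma> w ?x ?a ?v = tensor_deriv \<Gamma> w ?x ?v ?a" for w
    by (rule sym(2))
  have comb: "- (d2 + d + e + e) - 2 *\<^sub>R (e + g + j) = - d2 - d - 4 *\<^sub>R e - 2 *\<^sub>R g - 2 *\<^sub>R j"
    for d2 d e g j :: 'a
    by (rule euclidean_eqI) (simp add: inner_diff_left inner_add_left)
  have 3: "((\<lambda>t. geod_jerk \<Gamma> (\<gamma> t) (\<gamma>' t)) has_vector_derivative geod_snap \<Gamma> ?x ?v) (at t)"
    unfolding geod_jerk_def[of _ "\<gamma> _"]
    by (rule has_vector_derivative_eq_rhs[OF has_vector_derivative_diff[OF has_vector_derivative_minus[OF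
          tensor_deriv_has_vector_derivative[OF assms(1) T, where t = t, OF G(1,2) 1 1 1]]
          bounded_linear.has_vector_derivative[OF bounded_linear_scaleR_right
          tensor_has_vector_derivative[OF assms(1) T, where t = t, OF G(1,2) 1 2]]]])
      (simp only: geod_snap_def tensor_deriv2_def s2 comb)
  from less_4_cases[OF assms(5)] show ?thesis
    by (elim disjE) (use G(2) 1 2 3 in \<open>simp_all add: numeral_2_eq_2[symmetric]\<close>)
qed

lemma geod_jet_tendsto:
  assumes "open \<Omega>" and T: "smooth_sym_tensor \<Omega> \<Gamma>" and x: "x \<in> \<Omega>"
    and X: "(X \<longlongrightarrow> x) F" and V: "(V \<longlongrightarrow> v) F" and "k \<le> 4"
  shows "((\<lambda>s. geod_jet \<Gamma> k (X s) (V s)) \<longlongrightarrow> geod_jet \<Gamma> k x v) F"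
proof -
  note t = tensor_tendsto[OF assms(1) T x X] tensor_deriv_tendsto[OF assms(1) T x X]
    tensor_deriv_tendsto[OF assms(1) smooth_sym_tensor_tensor_deriv[OF assms(1) T] x X]
  have 1: "((\<lambda>s. geod_acc \<Gamma> (X s) (V s)) \<longlongrightarrow> geod_acc \<Gamma> x v) F"
    unfolding geod_acc_def by (intro tendsto_intros t V)
  have 2: "((\<lambda>s. geod_jerk \<Gamma> (X s) (V s)) \<longlongrightarrow> geod_jerk \<Gamma> x v) F"
    unfolding geod_jerk_def by (intro tendsto_intros t V 1)
  have 3: "((\<lambda>s. geod_snap \<Gamma> (X s) (V s)) \<longlongrightarrow> geod_snap \<Gamma> x v) F"
    unfolding geod_snap_def tensor_deriv2_def by (intro tendsto_intros t V 1 2)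
  have "k = 0 \<or> k = Suc 0 \<or> k = 2 \<or> k = 3 \<or> k = 4" using assms(6) by auto
  then show ?thesis
    by (elim disjE) (use X V 1 2 3 in simp_all)
qed

section \<open>Taylor expansion on shrinking intervals\<close>

text \<open>Taylor's formula for a function \<open>D 0 s\<close> that itself changes with the length \<open>s\<close> of the interval. The
  intermediate point in the Lagrange remainder depends on \<open>s\<close> and on the coordinate, so the top
  derivative has to converge along every choice of points in \<open>[-s,s]\<close>.\<close>

lemma taylor_limit_right:
  fixes D :: "nat \<Rightarrow> real \<Rightarrow> real \<Rightarrow> 'a::euclidean_space"
  assumes ev: "\<forall>\<^sub>F s in at_right 0. \<forall>k<n. \<forall>t\<in>{-s..s}. (D k s has_vector_derivative D (Suc k) s t) (at t)"
    and lim: "\<And>\<xi>. \<forall>\<^sub>F s in at_right 0. \<xi> s \<in> {-s..s} \<Longrightarrow> ((\<lambda>s. D n s (\<xi> s)) \<longlongrightarrow> l) (at_right 0)"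
  shows "((\<lambda>s. (1 / s ^ n) *\<^sub>R (D 0 s s - (\<Sum>k<n. (s ^ k / fact k) *\<^sub>R D k s 0)))
     \<longlongrightarrow> (1 / fact n) *\<^sub>R l) (at_right 0)"
proof (subst tendsto_componentwise_iff, rule ballI)
  fix i :: 'a assume "i \<in> Basis"
  let ?R = "\<lambda>s. D 0 s s - (\<Sum>k<n. (s ^ k / fact k) *\<^sub>R D k s 0)"
  have pos: "\<forall>\<^sub>F s in at_right 0. (0::real) < s" by (rule eventually_at_right_less)
  have "\<forall>\<^sub>F s in at_right 0. \<exists>\<xi>. \<xi> \<in> {-s..s} \<and> ?R s \<bullet> i = D n s \<xi> \<bullet> i / fact n * s ^ n"
    using ev pos
  proof eventually_elim
    fix s :: real
    assume D: "\<forall>k<n. \<forall>t\<in>{-s..s}. (D k s has_vector_derivative D (Suc k) s t) (at t)" and s: "0 < s"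
    have "\<exists>\<xi>. 0 < \<xi> \<and> \<xi> \<le> s \<and> (\<lambda>t. D 0 s t \<bullet> i) s =
        (\<Sum>k<n. (D k s 0 \<bullet> i) / fact k * s ^ k) + (D n s \<xi> \<bullet> i) / fact n * s ^ n"
    proof (rule Maclaurin2[OF s, where f = "\<lambda>t. D 0 s t \<bullet> i" and diff = "\<lambda>k t. D k s t \<bullet> i"])
      show "\<forall>k t. k < n \<and> 0 \<le> t \<and> t \<le> s \<longrightarrow> DERIV (\<lambda>t. D k s t \<bullet> i) t :> D (Suc k) s t \<bullet> i"
        using D unfolding has_real_derivative_iff_has_vector_derivative
        by (auto intro!: bounded_linear.has_vector_derivative[OF bounded_linear_inner_left])
    qed simp
    then obtain \<xi> where \<xi>: "0 < \<xi>" "\<xi> \<le> s" "D 0 s s \<bullet> i =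
        (\<Sum>k<n. (D k s 0 \<bullet> i) / fact k * s ^ k) + (D n s \<xi> \<bullet> i) / fact n * s ^ n" by blast
    show "\<exists>\<xi>. \<xi> \<in> {-s..s} \<and> ?R s \<bullet> i = D n s \<xi> \<bullet> i / fact n * s ^ n"
      by (rule exI[of _ \<xi>]) (use \<xi> in \<open>simp add: inner_diff_left inner_sum_left mult.commute\<close>)
  qed
  then obtain \<xi> where \<xi>: "\<forall>\<^sub>F s in at_right 0. \<xi> s \<in> {-s..s} \<and> ?R s \<bullet> i = D n s (\<xi> s) \<bullet> i / fact n * s ^ n"
    unfolding eventually_ex by blast
  have "((\<lambda>s. D n s (\<xi> s) \<bullet> i / fact n) \<longlongrightarrow> l \<bullet> i / fact n) (at_right 0)"
    by (intro tendsto_intros lim eventually_mono[OF \<xi>]) auto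
  then have "((\<lambda>s. ((1 / s ^ n) *\<^sub>R ?R s) \<bullet> i) \<longlongrightarrow> l \<bullet> i / fact n) (at_right 0)"
  proof (rule Lim_transform_eventually)
    show "\<forall>\<^sub>F s in at_right 0. D n s (\<xi> s) \<bullet> i / fact n = ((1 / s ^ n) *\<^sub>R ?R s) \<bullet> i"
      using \<xi> pos by eventually_elim simp
  qed
  then show "((\<lambda>s. ((1 / s ^ n) *\<^sub>R ?R s) \<bullet> i) \<longlongrightarrow> ((1 / fact n) *\<^sub>R l) \<bullet> i) (at_right 0)"
    by simp
qed

lemma taylor_limit_left:
  fixes D :: "nat \<Rightarrow> real \<Rightarrow> real \<Rightarrow> 'a::euclidean_space"
  assumes ev: "\<forall>\<^sub>F s in at_right 0. \<forall>k<n. \<forall>t\<in>{-s..s}. (D k s has_vector_derivative D (Suc k) s t) (at t)"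
    and lim: "\<And>\<xi>. \<forall>\<^sub>F s in at_right 0. \<xi> s \<in> {-s..s} \<Longrightarrow> ((\<lambda>s. D n s (\<xi> s)) \<longlongrightarrow> l) (at_right 0)"
  shows "((\<lambda>s. (1 / s ^ n) *\<^sub>R (D 0 s (-s) - (\<Sum>k<n. ((-s) ^ k / fact k) *\<^sub>R D k s 0)))
     \<longlongrightarrow> ((-1) ^ n / fact n) *\<^sub>R l) (at_right 0)"
proof -
  define E where "E k s t = (-1) ^ k *\<^sub>R D k s (- t)" for k s t
  have "((\<lambda>s. (1 / s ^ n) *\<^sub>R (E 0 s s - (\<Sum>k<n. (s ^ k / fact k) *\<^sub>R E k s 0)))
     \<longlongrightarrow> (1 / fact n) *\<^sub>R (-1) ^ n *\<^sub>R l) (at_right 0)"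
  proof (rule taylor_limit_right)
    show "\<forall>\<^sub>F s in at_right 0. \<forall>k<n. \<forall>t\<in>{-s..s}. (E k s has_vector_derivative E (Suc k) s t) (at t)"
      using ev
    proof (eventually_elim, intro allI impI ballI)
      fix s t :: real and k
      assume D: "\<forall>k<n. \<forall>t\<in>{-s..s}. (D k s has_vector_derivative D (Suc k) s t) (at t)"
        and "k < n" "t \<in> {-s..s}"
      then have d: "(D k s has_vector_derivative D (Suc k) s (-t)) (at (-t))" by auto
      have m: "((\<lambda>t::real. - t) has_vector_derivative -1) (at t)"
        by (auto intro!: derivative_eq_intros)
      show "(E k s has_vector_derivative E (Suc k) s t) (at t)"
        unfolding E_def
        using bounded_linear.has_vector_derivative[OF bounded_linear_scaleR_right
            vector_diff_chain_at[OF m d]] by (simp add: o_def)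
    qed
    fix \<xi> :: "real \<Rightarrow> real" assume "\<forall>\<^sub>F s in at_right 0. \<xi> s \<in> {-s..s}"
    then have "\<forall>\<^sub>F s in at_right 0. - \<xi> s \<in> {-s..s}" by eventually_elim auto
    then show "((\<lambda>s. E n s (\<xi> s)) \<longlongrightarrow> (-1) ^ n *\<^sub>R l) (at_right 0)"
      unfolding E_def by (intro tendsto_intros lim)
  qed
  moreover have "(s ^ k / fact k) *\<^sub>R E k s 0 = ((-s) ^ k / fact k) *\<^sub>R D k s 0" for s k
    by (simp add: E_def power_minus[of s])
  moreover have "E 0 s s = D 0 s (- s)" for s
    by (simp add: E_def)
  moreover have "(1 / fact n) *\<^sub>R (-1) ^ n *\<^sub>R l = ((-1) ^ n / fact n) *\<^sub>R l"
    by simp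
  ultimately show ?thesis by (simp only:)
qed

text \<open>The chain rule at a single point, for an arbitrary rate \<open>r\<close> in place of a parameter increment: if
  \<open>X - x\<close> is \<open>r w\<close> to first order, then \<open>f(X) - f(x)\<close> is \<open>r f'(w)\<close> to first order.\<close>

lemma has_derivative_scaled_limit:
  fixes f :: "'a::real_normed_vector \<Rightarrow> 'b::real_normed_vector"
  assumes f: "(f has_derivative f') (at x)" and X: "(X \<longlongrightarrow> x) F"
    and r: "\<forall>\<^sub>F s in F. 0 < r s" and w: "((\<lambda>s. (1 / r s) *\<^sub>R (X s - x)) \<longlongrightarrow> w) F"
  shows "((\<lambda>s. (1 / r s) *\<^sub>R (f (X s) - f x)) \<longlongrightarrow> f' w) F"
proof -
  \<comment> \<open>The relative error of the linear approximation. Division by zero gives it the value \<open>0\<close> at \<open>x\<close>,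
    which makes it continuous there.\<close>
  define \<epsilon> where "\<epsilon> y = (1 / norm (y - x)) *\<^sub>R (f y - f x - f' (y - x))" for y
  have lin: "bounded_linear f'" using f by (rule has_derivative_bounded_linear)
  have "(\<epsilon> \<longlongrightarrow> 0) (at x)"
    using f unfolding has_derivative_within \<epsilon>_def by (simp add: diff_diff_eq)
  then have "isCont \<epsilon> x" by (simp add: isCont_def \<epsilon>_def)
  then have "((\<lambda>s. \<epsilon> (X s)) \<longlongrightarrow> 0) F"
    using isCont_tendsto_compose[OF _ X] by (fastforce simp: \<epsilon>_def)
  then have "((\<lambda>s. norm ((1 / r s) *\<^sub>R (X s - x)) *\<^sub>R \<epsilon> (X s) + f' ((1 / r s) *\<^sub>R (X s - x))) \<longlongrightarrow>
      norm w *\<^sub>R 0 + f' w) F"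
    by (intro tendsto_intros w bounded_linear.tendsto[OF lin])
  then have "((\<lambda>s. norm ((1 / r s) *\<^sub>R (X s - x)) *\<^sub>R \<epsilon> (X s) + f' ((1 / r s) *\<^sub>R (X s - x))) \<longlongrightarrow> f' w) F"
    by simp
  then show ?thesis
  proof (rule Lim_transform_eventually)
    show "\<forall>\<^sub>F s in F. norm ((1 / r s) *\<^sub>R (X s - x)) *\<^sub>R \<epsilon> (X s) + f' ((1 / r s) *\<^sub>R (X s - x)) =
        (1 / r s) *\<^sub>R (f (X s) - f x)"
      using r
    proof eventually_elim
      fix s assume "0 < r s"
      have l: "f' (c *\<^sub>R v) = c *\<^sub>R f' v" "f' 0 = 0" for c v
        using linear_cmul linear_0 bounded_linear.linear[OF lin] by blast+
      show "norm ((1 / r s) *\<^sub>R (X s - x)) *\<^sub>R \<epsilon> (X s) + f' ((1 / r s) *\<^sub>R (X s - x)) =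
        (1 / r s) *\<^sub>R (f (X s) - f x)"
      proof (cases "X s = x")
        case False
        then have "norm ((1 / r s) *\<^sub>R (X s - x)) *\<^sub>R \<epsilon> (X s) =
            (1 / r s) *\<^sub>R (f (X s) - f x - f' (X s - x))"
          using \<open>0 < r s\<close> by (simp add: \<epsilon>_def)
        then show ?thesis unfolding l(1) by (simp add: scaleR_diff_right)
      qed (simp add: l)
    qed
  qed
qed

text \<open>In \<open>f(s) + f(-s)\<close> and \<open>f(s) - f(-s)\<close> the Taylor terms of odd and of even order cancel, respectively.\<close>

lemma symmetric_taylor_limits:
  fixes D :: "nat \<Rightarrow> real \<Rightarrow> real \<Rightarrow> 'a::euclidean_space"
  assumes ev: "\<forall>\<^sub>F s in at_right 0. \<forall>k<n. \<forall>t\<in>{-s..s}. (D k s has_vector_derivative D (Suc k) s t) (at t)"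
    and lim: "\<And>\<xi>. \<forall>\<^sub>F s in at_right 0. \<xi> s \<in> {-s..s} \<Longrightarrow> ((\<lambda>s. D n s (\<xi> s)) \<longlongrightarrow> l) (at_right 0)"
  shows symmetric_taylor_limit_2: "n = 2 \<Longrightarrow>
      ((\<lambda>s. (1 / s ^ 2) *\<^sub>R (D 0 s s + D 0 s (-s) - 2 *\<^sub>R D 0 s 0)) \<longlongrightarrow> l) (at_right 0)"
    and symmetric_taylor_limit_3: "n = 3 \<Longrightarrow>
      ((\<lambda>s. (1 / s ^ 3) *\<^sub>R (D 0 s s - D 0 s (-s) - (2 * s) *\<^sub>R D 1 s 0)) \<longlongrightarrow> (1 / 3) *\<^sub>R l) (at_right 0)"
    and symmetric_taylor_limit_4: "n = 4 \<Longrightarrow>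
      ((\<lambda>s. (1 / s ^ 4) *\<^sub>R (D 0 s s + D 0 s (-s) - 2 *\<^sub>R D 0 s 0 - s ^ 2 *\<^sub>R D 2 s 0))
        \<longlongrightarrow> (1 / 12) *\<^sub>R l) (at_right 0)"
proof -
  define P where "P s = (\<Sum>k<n. (s ^ k / fact k) *\<^sub>R D k s 0)" for s
  define M where "M s = (\<Sum>k<n. ((-s) ^ k / fact k) *\<^sub>R D k s 0)" for s
  note right = taylor_limit_right[OF ev lim, folded P_def]
  note left = taylor_limit_left[OF ev lim, folded M_def]
  note add = tendsto_add[OF right left, folded scaleR_add_right]
  note diff = tendsto_diff[OF right left, folded scaleR_diff_right]
  show "((\<lambda>s. (1 / s ^ 2) *\<^sub>R (D 0 s s + D 0 s (-s) - 2 *\<^sub>R D 0 s 0)) \<longlongrightarrow> l) (at_right 0)"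
    if n: "n = 2"
  proof -
    have "D 0 s s - P s + (D 0 s (-s) - M s) = D 0 s s + D 0 s (-s) - 2 *\<^sub>R D 0 s 0" for s
      unfolding P_def M_def n
      by (rule euclidean_eqI) (simp add: numeral_2_eq_2 inner_diff_left inner_add_left)
    moreover have "(1 / fact n) *\<^sub>R l + ((-1) ^ n / fact n) *\<^sub>R l = l"
      by (simp add: n flip: scaleR_add_left)
    ultimately show ?thesis using add by (simp only: n)
  qed
  show "((\<lambda>s. (1 / s ^ 3) *\<^sub>R (D 0 s s - D 0 s (-s) - (2 * s) *\<^sub>R D 1 s 0)) \<longlongrightarrow> (1 / 3) *\<^sub>R l) (at_right 0)"
    if n: "n = 3"
  proof -
    have "D 0 s s - P s - (D 0 s (-s) - M s) = D 0 s s - D 0 s (-s) - (2 * s) *\<^sub>R D 1 s 0" for s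
      unfolding P_def M_def n
      by (rule euclidean_eqI) (simp add: numeral_3_eq_3 inner_diff_left inner_add_left)
    moreover have "(1 / fact n) *\<^sub>R l - ((-1) ^ n / fact n) *\<^sub>R l = (1 / 3) *\<^sub>R l"
      by (rule euclidean_eqI) (simp add: n fact_numeral inner_diff_left inner_add_left)
    ultimately show ?thesis using diff by (simp only: n)
  qed
  show "((\<lambda>s. (1 / s ^ 4) *\<^sub>R (D 0 s s + D 0 s (-s) - 2 *\<^sub>R D 0 s 0 - s ^ 2 *\<^sub>R D 2 s 0))
        \<longlongrightarrow> (1 / 12) *\<^sub>R l) (at_right 0)"
    if n: "n = 4"
  proof -
    have "D 0 s s - P s + (D 0 s (-s) - M s) =
        D 0 s s + D 0 s (-s) - 2 *\<^sub>R D 0 s 0 - s ^ 2 *\<^sub>R D 2 s 0" for s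
      unfolding P_def M_def n
      by (rule euclidean_eqI) (simp add: eval_nat_numeral inner_diff_left inner_add_left)
    moreover have "(1 / fact n) *\<^sub>R l + ((-1) ^ n / fact n) *\<^sub>R l = (1 / 12) *\<^sub>R l"
      by (simp add: n fact_numeral flip: scaleR_add_left)
    ultimately show ?thesis using add by (simp only: n)
  qed
qed

section \<open>Pairs of geodesics with common endpoints\<close>

text \<open>Geodesics on the shrinking intervals \<open>[-s,s]\<close> whose positions and velocities converge to \<open>(m,h)\<close>
  uniformly as \<open>s\<close> decreases to \<open>0\<close>. Uniformity is what the Taylor remainders need; the derivatives
  of higher order then converge as well, because they are continuous functions of the first two.\<close>

definition geodesic_family ::
  "'a::euclidean_space set \<Rightarrow> 'a tensor12 \<Rightarrow> 'a \<Rightarrow> 'a \<Rightarrow> (real \<Rightarrow> real \<Rightarrow> 'a) \<Rightarrow> (real \<Rightarrow> real \<Rightarrow> 'a) \<Rightarrow> bool"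
  where
  "geodesic_family \<Omega> \<Gamma> m h \<beta> \<beta>' \<longleftrightarrow>
     (\<forall>\<^sub>F s in at_right 0. geodesic_on \<Omega> \<Gamma> {-s..s} (\<beta> s) (\<beta>' s)) \<and>
     (\<forall>e>0. \<forall>\<^sub>F s in at_right 0. \<forall>t\<in>{-s..s}. dist (\<beta> s t) m < e \<and> dist (\<beta>' s t) h < e)"

lemma geodesic_family_tendsto:
  assumes "geodesic_family \<Omega> \<Gamma> m h \<beta> \<beta>'" and "\<forall>\<^sub>F s in at_right 0. \<xi> s \<in> {-s..s}"
  shows "((\<lambda>s. \<beta> s (\<xi> s)) \<longlongrightarrow> m) (at_right 0)" "((\<lambda>s. \<beta>' s (\<xi> s)) \<longlongrightarrow> h) (at_right 0)"
proof -
  have *: "\<forall>\<^sub>F s in at_right 0. dist (\<beta> s (\<xi> s)) m < e \<and> dist (\<beta>' s (\<xi> s)) h < e" if "e > 0" for e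
  proof -
    have "\<forall>\<^sub>F s in at_right 0. \<forall>t\<in>{-s..s}. dist (\<beta> s t) m < e \<and> dist (\<beta>' s t) h < e"
      using assms(1) that unfolding geodesic_family_def by blast
    then show ?thesis using assms(2) by eventually_elim blast
  qed
  show "((\<lambda>s. \<beta> s (\<xi> s)) \<longlongrightarrow> m) (at_right 0)"
    by (intro tendstoI eventually_mono[OF *]) auto
  show "((\<lambda>s. \<beta>' s (\<xi> s)) \<longlongrightarrow> h) (at_right 0)"
    by (intro tendstoI eventually_mono[OF *]) auto
qed

lemma eventually_0_in_symmetric_interval: "\<forall>\<^sub>F s in at_right (0::real). 0 \<in> {-s..s}"
  using eventually_at_right_less[of 0] by eventually_elim auto

text \<open>Suppose that \<open>\<alpha> s\<close> and \<open>\<beta> s\<close> have the same endpoints and that their midpoints add up to the sum of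
  the endpoints. Then \<open>\<sigma> = \<alpha> + \<beta>\<close> satisfies \<open>\<sigma>(s) + \<sigma>(-s) = 2\<sigma>(0)\<close>, and \<open>\<delta> = \<beta> - \<alpha>\<close> vanishes at \<open>\<plusminus>s\<close>.
  The second and fourth order expansions of \<open>\<sigma>(s) + \<sigma>(-s) - 2\<sigma>(0)\<close> give the first and the last claim.
  The even and the odd part of \<open>\<delta>(\<plusminus>s) = 0\<close> give the distance of the two midpoints and of the two
  velocities at the midpoints; both are of order \<open>s\<^sup>2\<close>.\<close>

lemma matched_families_limits:
  fixes \<Gamma>1 \<Gamma>2 :: "'a::euclidean_space tensor12"
  assumes "open \<Omega>" and T: "smooth_sym_tensor \<Omega> \<Gamma>1" "smooth_sym_tensor \<Omega> \<Gamma>2" and m: "m \<in> \<Omega>"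
    and A: "geodesic_family \<Omega> \<Gamma>1 m h \<alpha> \<alpha>'" and B: "geodesic_family \<Omega> \<Gamma>2 m h \<beta> \<beta>'"
    and ends: "\<forall>\<^sub>F s in at_right 0. \<alpha> s s = \<beta> s s \<and> \<alpha> s (-s) = \<beta> s (-s) \<and>
      \<alpha> s 0 + \<beta> s 0 = \<alpha> s s + \<alpha> s (-s)"
  shows "\<Gamma>1 m h h + \<Gamma>2 m h h = 0"
    and "((\<lambda>s. (1 / s ^ 2) *\<^sub>R (\<beta> s 0 - \<alpha> s 0)) \<longlongrightarrow>
      (-1 / 2) *\<^sub>R (geod_acc \<Gamma>2 m h - geod_acc \<Gamma>1 m h)) (at_right 0)"
    and "((\<lambda>s. (1 / s ^ 2) *\<^sub>R (\<beta>' s 0 - \<alpha>' s 0)) \<longlongrightarrow>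
      (-1 / 6) *\<^sub>R (geod_jerk \<Gamma>2 m h - geod_jerk \<Gamma>1 m h)) (at_right 0)"
    and "((\<lambda>s. (1 / s ^ 2) *\<^sub>R (geod_acc \<Gamma>1 (\<alpha> s 0) (\<alpha>' s 0) + geod_acc \<Gamma>2 (\<beta> s 0) (\<beta>' s 0))) \<longlongrightarrow>
      (-1 / 12) *\<^sub>R (geod_snap \<Gamma>1 m h + geod_snap \<Gamma>2 m h)) (at_right 0)"
proof -
  let ?A = "\<lambda>k s t. geod_jet \<Gamma>1 k (\<alpha> s t) (\<alpha>' s t)" and ?B = "\<lambda>k s t. geod_jet \<Gamma>2 k (\<beta> s t) (\<beta>' s t)"
  have evA: "\<forall>\<^sub>F s in at_right 0. \<forall>k<n. \<forall>t\<in>{-s..s}. (?A k s has_vector_derivative ?A (Suc k) s t) (at t)"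
    if "n \<le> 4" for n
    using A[unfolded geodesic_family_def, THEN conjunct1]
    by eventually_elim (use geod_jet_has_vector_derivative[OF assms(1) T(1)] that in auto)
  have evB: "\<forall>\<^sub>F s in at_right 0. \<forall>k<n. \<forall>t\<in>{-s..s}. (?B k s has_vector_derivative ?B (Suc k) s t) (at t)"
    if "n \<le> 4" for n
    using B[unfolded geodesic_family_def, THEN conjunct1]
    by eventually_elim (use geod_jet_has_vector_derivative[OF assms(1) T(2)] that in auto)
  note limA = geod_jet_tendsto[OF assms(1) T(1) m geodesic_family_tendsto[OF A]]
  note limB = geod_jet_tendsto[OF assms(1) T(2) m geodesic_family_tendsto[OF B]]
  define S where "S k s t = ?A k s t + ?B k s t" for k s t
  define D where "D k s t = ?B k s t - ?A k s t" for k s t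
  have evS: "\<forall>\<^sub>F s in at_right 0. \<forall>k<n. \<forall>t\<in>{-s..s}. (S k s has_vector_derivative S (Suc k) s t) (at t)"
    and evD: "\<forall>\<^sub>F s in at_right 0. \<forall>k<n. \<forall>t\<in>{-s..s}. (D k s has_vector_derivative D (Suc k) s t) (at t)"
    if "n \<le> 4" for n
    unfolding S_def D_def using evA[OF that] evB[OF that]
    by (eventually_elim, auto intro!: has_vector_derivative_add has_vector_derivative_diff)+
  have limS: "((\<lambda>s. S n s (\<xi> s)) \<longlongrightarrow> geod_jet \<Gamma>1 n m h + geod_jet \<Gamma>2 n m h) (at_right 0)"
    and limD: "((\<lambda>s. D n s (\<xi> s)) \<longlongrightarrow> geod_jet \<Gamma>2 n m h - geod_jet \<Gamma>1 n m h) (at_right 0)"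
    if "n \<le> 4" "\<forall>\<^sub>F s in at_right 0. \<xi> s \<in> {-s..s}" for n \<xi>
    unfolding S_def D_def by (intro tendsto_intros limA limB that)+
  have endS: "\<forall>\<^sub>F s in at_right 0. S 0 s s + S 0 s (-s) - 2 *\<^sub>R S 0 s 0 = 0"
    using ends by eventually_elim (simp add: S_def scaleR_2)
  have endD: "\<forall>\<^sub>F s in at_right 0. D 0 s s = 0 \<and> D 0 s (-s) = 0"
    using ends by eventually_elim (simp add: D_def)
  have pos: "\<forall>\<^sub>F s in at_right 0. (0::real) < s" by (rule eventually_at_right_less)
  have "((\<lambda>s. (1 / s ^ 2) *\<^sub>R (S 0 s s + S 0 s (-s) - 2 *\<^sub>R S 0 s 0)) \<longlongrightarrow>
     geod_jet \<Gamma>1 2 m h + geod_jet \<Gamma>2 2 m h) (at_right 0)"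
    by (intro symmetric_taylor_limit_2[OF evS limS]) auto
  then have "((\<lambda>s::real. 0) \<longlongrightarrow> geod_jet \<Gamma>1 2 m h + geod_jet \<Gamma>2 2 m h) (at_right 0)"
    by (rule Lim_transform_eventually) (use endS in \<open>auto elim: eventually_mono\<close>)
  then have "geod_acc \<Gamma>1 m h + geod_acc \<Gamma>2 m h = 0"
    by (simp add: tendsto_const_iff)
  then show "\<Gamma>1 m h h + \<Gamma>2 m h h = 0"
    by (simp add: geod_acc_def add_eq_0_iff)
  have "((\<lambda>s. (-1 / 2) *\<^sub>R ((1 / s ^ 2) *\<^sub>R (D 0 s s + D 0 s (-s) - 2 *\<^sub>R D 0 s 0))) \<longlongrightarrow>
     (-1 / 2) *\<^sub>R (geod_jet \<Gamma>2 2 m h - geod_jet \<Gamma>1 2 m h)) (at_right 0)"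
    by (intro tendsto_scaleR tendsto_const symmetric_taylor_limit_2[OF evD limD]) auto
  then show "((\<lambda>s. (1 / s ^ 2) *\<^sub>R (\<beta> s 0 - \<alpha> s 0)) \<longlongrightarrow>
      (-1 / 2) *\<^sub>R (geod_acc \<Gamma>2 m h - geod_acc \<Gamma>1 m h)) (at_right 0)"
    unfolding geod_jet_simps
  proof (rule Lim_transform_eventually)
    show "\<forall>\<^sub>F s in at_right 0. (-1 / 2) *\<^sub>R ((1 / s ^ 2) *\<^sub>R (D 0 s s + D 0 s (-s) - 2 *\<^sub>R D 0 s 0)) =
        (1 / s ^ 2) *\<^sub>R (\<beta> s 0 - \<alpha> s 0)"
      using endD by eventually_elim (simp add: D_def)
  qed
  have "((\<lambda>s. (-1 / 2) *\<^sub>R ((1 / s ^ 3) *\<^sub>R (D 0 s s - D 0 s (-s) - (2 * s) *\<^sub>R D 1 s 0))) \<longlongrightarrow>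
     (-1 / 2) *\<^sub>R (1 / 3) *\<^sub>R (geod_jet \<Gamma>2 3 m h - geod_jet \<Gamma>1 3 m h)) (at_right 0)"
    by (intro tendsto_scaleR tendsto_const symmetric_taylor_limit_3[OF evD limD]) auto
  then have "((\<lambda>s. (-1 / 2) *\<^sub>R ((1 / s ^ 3) *\<^sub>R (D 0 s s - D 0 s (-s) - (2 * s) *\<^sub>R D 1 s 0))) \<longlongrightarrow>
     (-1 / 6) *\<^sub>R (geod_jerk \<Gamma>2 m h - geod_jerk \<Gamma>1 m h)) (at_right 0)"
    by simp
  then show "((\<lambda>s. (1 / s ^ 2) *\<^sub>R (\<beta>' s 0 - \<alpha>' s 0)) \<longlongrightarrow>
      (-1 / 6) *\<^sub>R (geod_jerk \<Gamma>2 m h - geod_jerk \<Gamma>1 m h)) (at_right 0)"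
  proof (rule Lim_transform_eventually)
    show "\<forall>\<^sub>F s in at_right 0.
        (-1 / 2) *\<^sub>R ((1 / s ^ 3) *\<^sub>R (D 0 s s - D 0 s (-s) - (2 * s) *\<^sub>R D 1 s 0)) =
        (1 / s ^ 2) *\<^sub>R (\<beta>' s 0 - \<alpha>' s 0)"
      using endD pos
      by eventually_elim (simp add: D_def power2_eq_square power3_eq_cube)
  qed
  have "((\<lambda>s. - ((1 / s ^ 4) *\<^sub>R (S 0 s s + S 0 s (-s) - 2 *\<^sub>R S 0 s 0 - s ^ 2 *\<^sub>R S 2 s 0))) \<longlongrightarrow>
     - ((1 / 12) *\<^sub>R (geod_jet \<Gamma>1 4 m h + geod_jet \<Gamma>2 4 m h))) (at_right 0)"
    by (intro tendsto_minus symmetric_taylor_limit_4[OF evS limS]) auto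
  then have "((\<lambda>s. - ((1 / s ^ 4) *\<^sub>R (S 0 s s + S 0 s (-s) - 2 *\<^sub>R S 0 s 0 - s ^ 2 *\<^sub>R S 2 s 0))) \<longlongrightarrow>
     (-1 / 12) *\<^sub>R (geod_snap \<Gamma>1 m h + geod_snap \<Gamma>2 m h)) (at_right 0)"
    by simp
  then show "((\<lambda>s. (1 / s ^ 2) *\<^sub>R (geod_acc \<Gamma>1 (\<alpha> s 0) (\<alpha>' s 0) + geod_acc \<Gamma>2 (\<beta> s 0) (\<beta>' s 0))) \<longlongrightarrow>
      (-1 / 12) *\<^sub>R (geod_snap \<Gamma>1 m h + geod_snap \<Gamma>2 m h)) (at_right 0)"
  proof (rule Lim_transform_eventually)
    show "\<forall>\<^sub>F s in at_right 0.
        - ((1 / s ^ 4) *\<^sub>R (S 0 s s + S 0 s (-s) - 2 *\<^sub>R S 0 s 0 - s ^ 2 *\<^sub>R S 2 s 0)) =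
        (1 / s ^ 2) *\<^sub>R (geod_acc \<Gamma>1 (\<alpha> s 0) (\<alpha>' s 0) + geod_acc \<Gamma>2 (\<beta> s 0) (\<beta>' s 0))"
      using endS pos
    proof eventually_elim
      fix s :: real assume "S 0 s s + S 0 s (-s) - 2 *\<^sub>R S 0 s 0 = 0" "0 < s"
      moreover have "s ^ 2 / s ^ 4 = 1 / s ^ 2"
        using \<open>0 < s\<close> by (simp add: field_simps flip: power_add)
      ultimately show "- ((1 / s ^ 4) *\<^sub>R (S 0 s s + S 0 s (-s) - 2 *\<^sub>R S 0 s 0 - s ^ 2 *\<^sub>R S 2 s 0)) =
        (1 / s ^ 2) *\<^sub>R (geod_acc \<Gamma>1 (\<alpha> s 0) (\<alpha>' s 0) + geod_acc \<Gamma>2 (\<beta> s 0) (\<beta>' s 0))"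
        by (simp add: S_def)
    qed
  qed
qed

text \<open>Write \<open>q = \<Gamma>(h,h)\<close> and \<open>d = (D\<^sub>h\<Gamma>)(h,h)\<close> at \<open>m\<close>, where \<open>\<Gamma> = \<Gamma>1\<close> and \<open>\<Gamma>2 = -\<Gamma>\<close>. Since the midpoint and
  velocity of \<open>\<beta> s\<close> differ from those of \<open>\<alpha> s\<close> by \<open>-s\<^sup>2 q\<close> and \<open>-s\<^sup>2 d/3\<close>, the sum of the two accelerations
  at the midpoints, which is \<open>\<Gamma>(\<beta>',\<beta>') - q\<close>, is \<open>s\<^sup>2\<close> times \<open>-(D\<^sub>q\<Gamma>)(h,h) - 2\<Gamma>(h,d)/3\<close> to leading order. It is
  also \<open>-s\<^sup>2/12\<close> times the sum of the fourth derivatives. In that sum the terms of odd degree in \<open>\<Gamma>\<close>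
  cancel and the quadratic ones double, which leaves
  \<open>2(D\<^sub>q\<Gamma>)(h,h) + 8(D\<^sub>h\<Gamma>)(h,q) + 4\<Gamma>(h,d)\<close>. Comparing the two expressions yields the obstruction.\<close>

lemma obstruction_of_matched_families:
  fixes \<Gamma>1 \<Gamma>2 :: "'a::euclidean_space tensor12"
  assumes "open \<Omega>" and T: "smooth_sym_tensor \<Omega> \<Gamma>1" "smooth_sym_tensor \<Omega> \<Gamma>2" and m: "m \<in> \<Omega>"
    and A: "geodesic_family \<Omega> \<Gamma>1 m h \<alpha> \<alpha>'" and B: "geodesic_family \<Omega> \<Gamma>2 m h \<beta> \<beta>'"
    and ends: "\<forall>\<^sub>F s in at_right 0. \<alpha> s s = \<beta> s s \<and> \<alpha> s (-s) = \<beta> s (-s) \<and>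
      \<alpha> s 0 + \<beta> s 0 = \<alpha> s s + \<alpha> s (-s)"
    and centre: "\<And>s. \<alpha> s 0 = m" "\<And>s. \<alpha>' s 0 = h"
    and neg: "\<And>x u v. x \<in> \<Omega> \<Longrightarrow> \<Gamma>2 x u v = - \<Gamma>1 x u v"
  shows "obstruction \<Gamma>1 m h = 0"
proof -
  note lims = matched_families_limits[OF assms(1) T m A B ends]
  define q where "q = \<Gamma>1 m h h"
  define d where "d = tensor_deriv \<Gamma>1 h m h h"
  have lin: "linear (\<lambda>u. \<Gamma>1 m u v)" "linear (\<Gamma>1 m u)" for u v
    using smooth_sym_tensor_bilinear[OF T(1) m] by (auto simp: bilinear_def)
  have lin': "linear (\<lambda>u. tensor_deriv \<Gamma>1 w m u v)" "linear (tensor_deriv \<Gamma>1 w m u)" for w u v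
    using smooth_sym_tensor_bilinear[OF smooth_sym_tensor_tensor_deriv[OF assms(1) T(1)] m]
    by (auto simp: bilinear_def)
  note linD = smooth_sym_tensor_linear_deriv[OF T(1) m]
  note neg_simps = linear_neg[OF lin(1)] linear_neg[OF lin(2)] linear_neg[OF lin'(1)]
    linear_neg[OF lin'(2)] linear_neg[OF linD]
  have negD: "tensor_deriv \<Gamma>2 w x u v = - tensor_deriv \<Gamma>1 w x u v" if "x \<in> \<Omega>" for w x u v
    by (rule tensor_deriv_eqI[OF assms(1) that neg has_derivative_minus[OF
          smooth_sym_tensor_has_derivative[OF T(1) that]]])
  have negD2: "tensor_deriv2 \<Gamma>2 m h = - tensor_deriv2 \<Gamma>1 m h"
  proof -
    have "tensor_deriv (tensor_deriv \<Gamma>2 k) h m h h = - tensor_deriv (tensor_deriv \<Gamma>1 k) h m h h" for k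
      by (rule tensor_deriv_eqI[OF assms(1) m negD has_derivative_minus[OF
            smooth_sym_tensor_has_derivative[OF smooth_sym_tensor_tensor_deriv[OF assms(1) T(1)] m]]])
    then show ?thesis by (simp add: tensor_deriv2_def sum_negf)
  qed
  have acc: "geod_acc \<Gamma>1 m h = - q" "geod_acc \<Gamma>2 m h = q"
    using neg[OF m] by (simp_all add: geod_acc_def q_def)
  have jerk: "geod_jerk \<Gamma>1 m h = - d + 2 *\<^sub>R \<Gamma>1 m h q" "geod_jerk \<Gamma>2 m h = d + 2 *\<^sub>R \<Gamma>1 m h q"
    by (simp_all add: geod_jerk_def acc neg[OF m] negD[OF m] neg_simps d_def)
  have snap: "geod_snap \<Gamma>1 m h + geod_snap \<Gamma>2 m h =
      2 *\<^sub>R tensor_deriv \<Gamma>1 q m h h + 8 *\<^sub>R tensor_deriv \<Gamma>1 h m h q + 4 *\<^sub>R \<Gamma>1 m h d"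
    by (rule euclidean_eqI)
      (simp add: geod_snap_def acc jerk neg[OF m] negD[OF m] negD2 neg_simps
        linear_add[OF lin(2)] linear_diff[OF lin(2)] linear_cmul[OF lin(2)] algebra_simps
        inner_add_left inner_diff_left)
  have "((\<lambda>s. (1 / s ^ 2) *\<^sub>R (\<beta> s 0 - m)) \<longlongrightarrow> - q) (at_right 0)"
    using lims(2) by (simp add: centre acc flip: scaleR_2)
  moreover have "((\<lambda>s. (1 / s ^ 2) *\<^sub>R (\<beta>' s 0 - h)) \<longlongrightarrow> (-1 / 3) *\<^sub>R d) (at_right 0)"
    using lims(3) by (simp add: centre jerk flip: scaleR_2)
  ultimately have "((\<lambda>s. (1 / s ^ 2) *\<^sub>R ((\<beta> s 0, \<beta>' s 0) - (m, h))) \<longlongrightarrow> (- q, (-1 / 3) *\<^sub>R d)) (at_right 0)"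
    by (auto dest: tendsto_Pair)
  then have "((\<lambda>s. (1 / s ^ 2) *\<^sub>R ((\<lambda>z. \<Gamma>1 (fst z) (snd z) (snd z)) (\<beta> s 0, \<beta>' s 0) -
        (\<lambda>z. \<Gamma>1 (fst z) (snd z) (snd z)) (m, h))) \<longlongrightarrow>
     tensor_deriv \<Gamma>1 (fst (- q, (-1 / 3) *\<^sub>R d)) (fst (m, h)) (snd (m, h)) (snd (m, h))
     + \<Gamma>1 (fst (m, h)) (snd (- q, (-1 / 3) *\<^sub>R d)) (snd (m, h))
     + \<Gamma>1 (fst (m, h)) (snd (m, h)) (snd (- q, (-1 / 3) *\<^sub>R d))) (at_right 0)"
  proof (rule has_derivative_scaled_limit[rotated 3])
    show "((\<lambda>z. \<Gamma>1 (fst z) (snd z) (snd z)) has_derivative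
      (\<lambda>k. tensor_deriv \<Gamma>1 (fst k) (fst (m, h)) (snd (m, h)) (snd (m, h))
        + \<Gamma>1 (fst (m, h)) (snd k) (snd (m, h)) + \<Gamma>1 (fst (m, h)) (snd (m, h)) (snd k))) (at (m, h))"
      by (rule tensor_has_derivative[OF assms(1) T(1)])
        (auto simp: m intro: bounded_linear_imp_has_derivative bounded_linear_fst bounded_linear_snd)
    show "((\<lambda>s. (\<beta> s 0, \<beta>' s 0)) \<longlongrightarrow> (m, h)) (at_right 0)"
      using geodesic_family_tendsto[OF B eventually_0_in_symmetric_interval] by (rule tendsto_Pair)
    show "\<forall>\<^sub>F s in at_right 0. (0::real) < s ^ 2"
      using eventually_at_right_less[of "0::real"] by eventually_elim simp
  qed
  moreover have thirds: "- x - (1 / 3) *\<^sub>R y - (1 / 3) *\<^sub>R y = - x - (2 / 3) *\<^sub>R y" for x y :: 'a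
    by (rule euclidean_eqI) (simp add: inner_diff_left)
  ultimately have L1: "((\<lambda>s. (1 / s ^ 2) *\<^sub>R (\<Gamma>1 (\<beta> s 0) (\<beta>' s 0) (\<beta>' s 0) - q)) \<longlongrightarrow>
     - tensor_deriv \<Gamma>1 q m h h - (2 / 3) *\<^sub>R \<Gamma>1 m h d) (at_right 0)"
    by (simp add: q_def[symmetric] neg_simps linear_cmul[OF lin(2)] linear_cmul[OF lin(1)]
        smooth_sym_tensor_sym[OF T(1) m, of d h] thirds)
  have "((\<lambda>s. (1 / s ^ 2) *\<^sub>R (\<Gamma>1 (\<beta> s 0) (\<beta>' s 0) (\<beta>' s 0) - q)) \<longlongrightarrow>
     (-1 / 12) *\<^sub>R (geod_snap \<Gamma>1 m h + geod_snap \<Gamma>2 m h)) (at_right 0)"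
    using lims(4)
  proof (rule Lim_transform_eventually)
    have "\<forall>\<^sub>F s in at_right 0. \<beta> s 0 \<in> \<Omega>"
      using topological_tendstoD[OF geodesic_family_tendsto(1)[OF B
            eventually_0_in_symmetric_interval] assms(1) m] .
    then show "\<forall>\<^sub>F s in at_right 0.
       (1 / s ^ 2) *\<^sub>R (geod_acc \<Gamma>1 (\<alpha> s 0) (\<alpha>' s 0) + geod_acc \<Gamma>2 (\<beta> s 0) (\<beta>' s 0)) =
       (1 / s ^ 2) *\<^sub>R (\<Gamma>1 (\<beta> s 0) (\<beta>' s 0) (\<beta>' s 0) - q)"
      by eventually_elim (simp add: centre acc(1), simp add: geod_acc_def neg)
  qed
  then have "- tensor_deriv \<Gamma>1 q m h h - (2 / 3) *\<^sub>R \<Gamma>1 m h d =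
      (-1 / 12) *\<^sub>R (geod_snap \<Gamma>1 m h + geod_snap \<Gamma>2 m h)"
    using tendsto_unique[OF _ L1] by simp
  then have eq: "(- tensor_deriv \<Gamma>1 q m h h - (2 / 3) *\<^sub>R \<Gamma>1 m h d) \<bullet> i =
      ((-1 / 12) *\<^sub>R (2 *\<^sub>R tensor_deriv \<Gamma>1 q m h h + 8 *\<^sub>R tensor_deriv \<Gamma>1 h m h q + 4 *\<^sub>R \<Gamma>1 m h d)) \<bullet> i" for i
    unfolding snap by simp
  show ?thesis
    unfolding obstruction_def q_def[symmetric] d_def[symmetric]
  proof (rule euclidean_eqI)
    fix i :: 'a
    show "(2 *\<^sub>R \<Gamma>1 m h d + 5 *\<^sub>R tensor_deriv \<Gamma>1 q m h h - 4 *\<^sub>R tensor_deriv \<Gamma>1 h m h q) \<bullet> i = 0 \<bullet> i"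
      using eq[of i] by (simp add: inner_add_left inner_diff_left field_simps)
  qed
qed

section \<open>The exponential map near the zero section\<close>

lemma geod_exp_zero:
  fixes \<Gamma> :: "'a::euclidean_space tensor12"
  assumes "open \<Omega>" and T: "smooth_sym_tensor \<Omega> \<Gamma>" and "P \<in> \<Omega>"
  shows "geod_exp \<Omega> \<Gamma> P 0 = P"
proof (rule geod_exp_eqI[OF assms(1,2)])
  have "\<Gamma> P 0 0 = 0"
    using smooth_sym_tensor_bilinear[OF T assms(3)] linear_0 by (auto simp: bilinear_def)
  then have "geodesic_on \<Omega> \<Gamma> UNIV (\<lambda>_. P) (\<lambda>_. 0)"
    using assms(3) by (auto simp: geodesic_on_def intro!: exI[of _ 0])
  then show "exp_rel \<Omega> \<Gamma> P 0 P"
    unfolding exp_rel_def by (intro exI[of _ UNIV] exI) (auto intro: is_interval_univ)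
qed

text \<open>Short initial vectors lie in the domain of the exponential map, and rescaling the parameter turns
  the resulting geodesic into one with the prescribed velocity. The interval on which an exponential is
  realized is open around \<open>0\<close>, so the geodesic extends to negative times.\<close>

lemma geodesic_through:
  fixes \<Gamma> :: "'a::euclidean_space tensor12"
  assumes T: "smooth_sym_tensor \<Omega> \<Gamma>"
    and U: "open U" "(m, 0) \<in> U" "U \<subseteq> exp_dom \<Omega> \<Gamma>"
  obtains r \<alpha> \<alpha>' where "r > 0" "geodesic_on \<Omega> \<Gamma> {-r<..<r} \<alpha> \<alpha>'" "\<alpha> 0 = m" "\<alpha>' 0 = h"
proof -
  have "((\<lambda>\<epsilon>::real. (m, \<epsilon> *\<^sub>R h)) \<longlongrightarrow> (m, 0 *\<^sub>R h)) (at_right 0)"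
    by (intro tendsto_intros)
  then have "\<forall>\<^sub>F \<epsilon>::real in at_right 0. (m, \<epsilon> *\<^sub>R h) \<in> U"
    using topological_tendstoD[OF _ U(1)] U(2) by simp
  then have "\<forall>\<^sub>F \<epsilon>::real in at_right 0. (m, \<epsilon> *\<^sub>R h) \<in> U \<and> 0 < \<epsilon>"
    using eventually_at_right_less[of "0::real"] by eventually_elim simp
  then obtain \<epsilon> :: real where \<epsilon>: "(m, \<epsilon> *\<^sub>R h) \<in> U" "0 < \<epsilon>"
    using eventually_happens'[OF trivial_limit_at_right_real] by blast
  then have "(m, \<epsilon> *\<^sub>R h) \<in> exp_dom \<Omega> \<Gamma>" using U(3) by blast
  then obtain Q where "exp_rel \<Omega> \<Gamma> m (\<epsilon> *\<^sub>R h) Q" by (auto simp: exp_dom_def)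
  then obtain J \<gamma> \<gamma>' where J: "open J" "{0..1} \<subseteq> J" "geodesic_on \<Omega> \<Gamma> J \<gamma> \<gamma>'" "\<gamma> 0 = m" "\<gamma>' 0 = \<epsilon> *\<^sub>R h"
    unfolding exp_rel_def by blast
  then have "0 \<in> J" by auto
  with J(1) obtain d where d: "d > 0" "ball 0 d \<subseteq> J" using open_contains_ball by blast
  show ?thesis
  proof (rule that[of "\<epsilon> * d" "\<lambda>t. \<gamma> (0 + (1 / \<epsilon>) * t)" "\<lambda>t. (1 / \<epsilon>) *\<^sub>R \<gamma>' (0 + (1 / \<epsilon>) * t)"])
    show "\<epsilon> * d > 0" using d \<epsilon> by simp
    have "{-(\<epsilon> * d)<..<\<epsilon> * d} \<subseteq> {t. 0 + (1 / \<epsilon>) * t \<in> J}"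
    proof
      fix t assume "t \<in> {-(\<epsilon> * d)<..<\<epsilon> * d}"
      then have "\<bar>t\<bar> / \<epsilon> < d" using \<epsilon>(2) by (auto simp: divide_less_eq mult.commute)
      then have "t / \<epsilon> \<in> ball 0 d" using \<epsilon>(2) by (simp add: dist_real_def)
      then show "t \<in> {t. 0 + (1 / \<epsilon>) * t \<in> J}" using d(2) by auto
    qed
    then show "geodesic_on \<Omega> \<Gamma> {-(\<epsilon> * d)<..<\<epsilon> * d} (\<lambda>t. \<gamma> (0 + (1 / \<epsilon>) * t))
        (\<lambda>t. (1 / \<epsilon>) *\<^sub>R \<gamma>' (0 + (1 / \<epsilon>) * t))"
      using geodesic_on_subset[OF geodesic_on_affine[OF T J(3)]] by blast
  qed (use J \<epsilon> in auto)
qed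

lemma smooth_on_has_derivative:
  assumes "smooth_on S f" "x \<in> S"
  shows "(f has_derivative frechet_derivative f (at x)) (at x)"
proof -
  have "Ck_on (Suc 0) S f" using assms(1) unfolding smooth_on_def by blast
  then show ?thesis using assms(2) by (simp add: frechet_derivative_works)
qed

lemma smooth_on_continuous_deriv:
  assumes "smooth_on S f"
  shows "continuous_on S (\<lambda>x. frechet_derivative f (at x) v)"
proof -
  have "Ck_on (Suc 0) S f" using assms(1) unfolding smooth_on_def by blast
  then show ?thesis by simp
qed

lemma dist_Pair_zero_le: "dist (P, x) (m, 0) \<le> dist P m + norm x"
  using sqrt_sum_squares_le_sum[of "dist P m" "norm x"] by (simp add: dist_Pair_Pair)

text \<open>The velocity at time \<open>\<tau>\<close> is the derivative of \<open>\<tau> \<mapsto> Exp\<^sub>P(\<tau>w)\<close>, so a bound for the derivative of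
  the exponential map near the zero section bounds it by the initial velocity.\<close>

lemma exp_velocity_bound:
  fixes \<Gamma> :: "'a::euclidean_space tensor12"
  assumes "open \<Omega>" and T: "smooth_sym_tensor \<Omega> \<Gamma>" and U: "open U" "(m, 0) \<in> U"
    and F: "smooth_on U (\<lambda>(P, v). (P, geod_exp \<Omega> \<Gamma> P v))"
  obtains C \<rho> where "C \<ge> 0" "\<rho> > 0"
    "\<And>J \<gamma> \<gamma>' \<tau>. \<lbrakk>open J; is_interval J; {0..1} \<subseteq> J; geodesic_on \<Omega> \<Gamma> J \<gamma> \<gamma>';
        dist (\<gamma> 0) m < \<rho>; norm (\<gamma>' 0) < \<rho>; \<tau> \<in> {0..1}\<rbrakk> \<Longrightarrow> norm (\<gamma>' \<tau>) \<le> C * norm (\<gamma>' 0)"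
proof -
  let ?F = "\<lambda>(P, v). (P, geod_exp \<Omega> \<Gamma> P v)"
  define d where "d i z = frechet_derivative ?F (at z) (0, i)" for i z
  define C where "C = (\<Sum>i\<in>Basis. norm (d i (m, 0)) + 1)"
  have "\<forall>\<^sub>F z in nhds (m, 0). norm (d i z) < norm (d i (m, 0)) + 1" for i
  proof -
    have "isCont (d i) (m, 0)"
      using smooth_on_continuous_deriv[OF F] U continuous_on_eq_continuous_at unfolding d_def by blast
    then have "((\<lambda>z. norm (d i z)) \<longlongrightarrow> norm (d i (m, 0))) (nhds (m, 0))"
      unfolding isCont_def tendsto_at_iff_tendsto_nhds by (rule tendsto_norm)
    then show ?thesis by (rule order_tendstoD) simp
  qed
  then have "\<forall>\<^sub>F z in nhds (m, 0). z \<in> U \<and> (\<forall>i\<in>Basis. norm (d i z) < norm (d i (m, 0)) + 1)"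
    by (intro eventually_conj eventually_ball_finite eventually_nhds_in_open U) auto
  then obtain \<epsilon> where \<epsilon>: "\<epsilon> > 0" "\<And>z. dist z (m, 0) < \<epsilon> \<Longrightarrow>
      z \<in> U \<and> (\<forall>i\<in>Basis. norm (d i z) < norm (d i (m, 0)) + 1)"
    unfolding eventually_nhds_metric by blast
  show ?thesis
  proof (rule that[of C "\<epsilon> / 2"])
    show "C \<ge> 0" unfolding C_def by (intro sum_nonneg) auto
    show "\<epsilon> / 2 > 0" using \<epsilon> by simp
    fix J \<gamma> \<gamma>' and \<tau> :: real
    assume J: "open J" "is_interval J" "{0..1} \<subseteq> J" and g: "geodesic_on \<Omega> \<Gamma> J \<gamma> \<gamma>'"
      and small: "dist (\<gamma> 0) m < \<epsilon> / 2" "norm (\<gamma>' 0) < \<epsilon> / 2" and \<tau>: "\<tau> \<in> {0..1}"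
    let ?w = "\<gamma>' 0" and ?z = "(\<gamma> 0, \<tau> *\<^sub>R \<gamma>' 0)"
    have J0: "0 \<in> J" "\<tau> \<in> J" using J \<tau> by auto
    have "norm (\<tau> *\<^sub>R ?w) \<le> norm ?w" using \<tau> by (simp add: mult_left_le_one_le)
    then have "dist ?z (m, 0) < \<epsilon>"
      using dist_Pair_zero_le[of "\<gamma> 0" "\<tau> *\<^sub>R ?w" m] small by linarith
    then have z: "?z \<in> U" "\<And>i. i \<in> Basis \<Longrightarrow> norm (d i ?z) \<le> norm (d i (m, 0)) + 1"
      using \<epsilon>(2) by (auto intro: less_imp_le)
    let ?D = "frechet_derivative ?F (at ?z)"
    have D: "(?F has_derivative ?D) (at ?z)" by (rule smooth_on_has_derivative[OF F z(1)])
    then have lin: "linear ?D" by (rule has_derivative_linear)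
    have "((\<lambda>\<sigma>. (\<gamma> 0, \<sigma> *\<^sub>R ?w)) has_derivative (\<lambda>k. (0, k *\<^sub>R ?w))) (at \<tau>)"
      by (auto intro!: derivative_eq_intros)
    from has_derivative_compose[OF this D]
    have "((\<lambda>\<sigma>. snd (?F (\<gamma> 0, \<sigma> *\<^sub>R ?w))) has_derivative (\<lambda>k. snd (?D (0, k *\<^sub>R ?w)))) (at \<tau>)"
      by (intro bounded_linear.has_derivative[OF bounded_linear_snd])
    moreover have "?D (0, k *\<^sub>R ?w) = k *\<^sub>R ?D (0, ?w)" for k
      using linear_cmul[OF lin, of k "(0, ?w)"] by simp
    ultimately have "((\<lambda>\<sigma>. geod_exp \<Omega> \<Gamma> (\<gamma> 0) (\<sigma> *\<^sub>R ?w)) has_vector_derivative snd (?D (0, ?w))) (at \<tau>)"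
      by (simp add: has_vector_derivative_def)
    then have "(\<gamma> has_vector_derivative snd (?D (0, ?w))) (at \<tau>)"
    proof (rule has_vector_derivative_transform_within_open[OF _ J(1) J0(2)])
      show "geod_exp \<Omega> \<Gamma> (\<gamma> 0) (\<sigma> *\<^sub>R ?w) = \<gamma> \<sigma>" if "\<sigma> \<in> J" for \<sigma>
        using geod_exp_along_geodesic[OF assms(1) T J(1,2) g J0(1) that] by simp
    qed
    then have "\<gamma>' \<tau> = snd (?D (0, ?w))"
      by (rule vector_derivative_unique_at[OF geodesic_onD(2)[OF g J0(2)]])
    also have "norm \<dots> \<le> norm (?D (0, ?w))"
      by (cases "?D (0, ?w)") (simp only: snd_conv norm_snd_le)
    also have "(0, ?w) = (\<Sum>i\<in>Basis. (?w \<bullet> i) *\<^sub>R (0, i))"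
      by (simp add: prod_eq_iff fst_sum snd_sum euclidean_representation)
    also have "norm (?D \<dots>) = norm (\<Sum>i\<in>Basis. (?w \<bullet> i) *\<^sub>R d i ?z)"
      unfolding d_def linear_sum[OF lin] linear_cmul[OF lin] ..
    also have "\<dots> \<le> (\<Sum>i\<in>Basis. norm ?w * (norm (d i (m, 0)) + 1))"
      by (rule sum_norm_le) (auto intro!: mult_mono z(2) Basis_le_norm)
    also have "\<dots> = C * norm ?w"
      unfolding C_def sum_distrib_right by (simp only: mult.commute)
    finally show "norm (\<gamma>' \<tau>) \<le> C * norm (\<gamma>' 0)" .
  qed
qed

lemma vector_derivative_quotient_limit:
  fixes f :: "real \<Rightarrow> 'a::real_normed_vector"
  assumes "(f has_vector_derivative f') (at 0)"
  shows "((\<lambda>s. (1 / s) *\<^sub>R (f s - f 0)) \<longlongrightarrow> f') (at_right 0)"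
proof -
  have pos: "\<forall>\<^sub>F s in at_right 0. (0::real) < s" by (rule eventually_at_right_less)
  have "((\<lambda>s::real. (1 / s) *\<^sub>R (s - 0)) \<longlongrightarrow> 1) (at_right 0)"
    by (rule Lim_transform_eventually[OF tendsto_const]) (use pos in \<open>auto elim: eventually_mono\<close>)
  from has_derivative_scaled_limit[OF assms[unfolded has_vector_derivative_def] _ pos this]
  show ?thesis by (simp add: tendsto_ident_at)
qed

text \<open>The exponential map is injective on each fibre of \<open>U\<close>, so the branch of its inverse that defines the
  midpoint map returns the vector \<open>v\<close> itself.\<close>

lemma midpoint_of_geod_exp:
  assumes W: "diffeomorphism_on U W (\<lambda>(P, v). (P, geod_exp \<Omega> \<Gamma> P v))"
    and M: "\<forall>(P, Q) \<in> W. M P Q =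
      geod_exp \<Omega> \<Gamma> P ((1/2) *\<^sub>R inv_into {v. (P, v) \<in> U} (geod_exp \<Omega> \<Gamma> P) Q)"
    and v: "(P, v) \<in> U"
  shows "M P (geod_exp \<Omega> \<Gamma> P v) = geod_exp \<Omega> \<Gamma> P ((1/2) *\<^sub>R v)"
proof -
  have bij: "bij_betw (\<lambda>(P, v). (P, geod_exp \<Omega> \<Gamma> P v)) U W"
    using W by (simp add: diffeomorphism_on_def)
  then have "(P, geod_exp \<Omega> \<Gamma> P v) \<in> W" using v bij_betwE by fastforce
  moreover have "inj_on (geod_exp \<Omega> \<Gamma> P) {v. (P, v) \<in> U}"
    using bij unfolding bij_betw_def inj_on_def by fastforce
  then have "inv_into {v. (P, v) \<in> U} (geod_exp \<Omega> \<Gamma> P) (geod_exp \<Omega> \<Gamma> P v) = v"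
    using v by (simp add: inv_into_f_f)
  ultimately show ?thesis using M by fastforce
qed

section \<open>Geodesics spanned by short chords\<close>

text \<open>The mean value inequality for \<open>\<beta>(\<sigma>) - \<sigma>\<beta>'(t)\<close>, whose derivative \<open>\<beta>'(\<sigma>) - \<beta>'(t)\<close> is in turn at most
  \<open>2Ks\<close>.\<close>

lemma symmetric_interval_vector_derivative_norm_bound:
  fixes \<beta> :: "real \<Rightarrow> 'a::real_normed_vector"
  assumes s: "0 < s" and t: "t \<in> {-s..s}" and "0 \<le> K"
    and 1: "\<And>t. t \<in> {-s..s} \<Longrightarrow> (\<beta> has_vector_derivative \<beta>' t) (at t)"
    and 2: "\<And>t. t \<in> {-s..s} \<Longrightarrow> (\<beta>' has_vector_derivative a t) (at t)"
    and K: "\<And>t. t \<in> {-s..s} \<Longrightarrow> norm (a t) \<le> K"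
  shows "norm (\<beta>' t - (1 / (2 * s)) *\<^sub>R (\<beta> s - \<beta> (-s))) \<le> 2 * K * s"
proof -
  have "norm ((\<beta> s - s *\<^sub>R \<beta>' t) - (\<beta> (-s) - (-s) *\<^sub>R \<beta>' t)) \<le> (K * (2 * s)) * \<bar>s - (-s)\<bar>"
  proof (rule vector_derivative_norm_bound[where S = "{-s..s}"])
    fix \<sigma> assume \<sigma>: "\<sigma> \<in> {-s..s}"
    show "((\<lambda>\<sigma>. \<beta> \<sigma> - \<sigma> *\<^sub>R \<beta>' t) has_vector_derivative \<beta>' \<sigma> - \<beta>' t) (at \<sigma>)"
      by (auto intro!: derivative_eq_intros 1[OF \<sigma>])
    have "norm (\<beta>' \<sigma> - \<beta>' t) \<le> K * \<bar>\<sigma> - t\<bar>"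
      by (rule vector_derivative_norm_bound[where S = "{-s..s}"]) (use t \<sigma> 2 K in auto)
    also have "\<dots> \<le> K * (2 * s)"
      using t \<sigma> assms(3) by (intro mult_left_mono) auto
    finally show "norm (\<beta>' \<sigma> - \<beta>' t) \<le> K * (2 * s)" .
  qed (use s in auto)
  moreover have "(\<beta> s - s *\<^sub>R \<beta>' t) - (\<beta> (-s) - (-s) *\<^sub>R \<beta>' t) =
      (- (2 * s)) *\<^sub>R (\<beta>' t - (1 / (2 * s)) *\<^sub>R (\<beta> s - \<beta> (-s)))" (is "_ = _ *\<^sub>R ?d")
  proof -
    have "(x - s *\<^sub>R v) - (y - (-s) *\<^sub>R v) = (x - y) - (2 * s) *\<^sub>R v" for x y v :: 'a
      by (simp add: algebra_simps flip: scaleR_add_left mult_2)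
    then show ?thesis using s by (simp add: scaleR_diff_right[of "2 * s"])
  qed
  ultimately have "(2 * s) * norm ?d \<le> (2 * s) * (2 * K * s)"
    using s by (simp add: mult_ac)
  then show ?thesis using s by simp
qed

lemma tensor_locally_bounded:
  fixes T :: "'a::euclidean_space tensor12"
  assumes "open \<Omega>" and T: "smooth_sym_tensor \<Omega> T" and "m \<in> \<Omega>"
  obtains e K where "e > 0" "0 \<le> K" "\<And>x v. dist x m < e \<Longrightarrow> norm v \<le> B \<Longrightarrow> norm (T x v v) \<le> K"
proof -
  obtain e where e: "e > 0" "cball m e \<subseteq> \<Omega>"
    using assms(1,3) open_contains_cball by blast
  let ?S = "cball m e \<times> cball (0::'a) B"
  have "continuous_on ?S (\<lambda>z. T (fst z) (snd z) (snd z))"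
    unfolding continuous_on_def
  proof (intro ballI tensor_tendsto[OF assms(1,2)] tendsto_intros)
    fix z assume "z \<in> ?S" then show "fst z \<in> \<Omega>" using e by auto
  qed
  then have "compact ((\<lambda>z. T (fst z) (snd z) (snd z)) ` ?S)"
    by (rule compact_continuous_image) (intro compact_Times compact_cball)
  then obtain K where K: "\<forall>x\<in>(\<lambda>z. T (fst z) (snd z) (snd z)) ` ?S. norm x \<le> K"
    using compact_imp_bounded bounded_iff by metis
  show ?thesis
  proof (rule that[of e "max K 0"])
    fix x v :: 'a assume "dist x m < e" "norm v \<le> B"
    then have "(x, v) \<in> ?S" by (auto simp: dist_commute)
    then have "norm ((\<lambda>z. T (fst z) (snd z) (snd z)) (x, v)) \<le> K" using K by blast
    then show "norm (T x v v) \<le> max K 0" by simp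
  qed (use e in auto)
qed

text \<open>The geodesic from \<open>\<alpha>(-s)\<close> to \<open>\<alpha>(s)\<close> that the midpoint map bisects has initial vector
  \<open>w(s) = Exp\<inverse>(\<alpha>(s))\<close> at \<open>\<alpha>(-s)\<close>. As the inverse of the exponential map is differentiable at \<open>(m,m)\<close>,
  \<open>w(s)\<close> is of order \<open>s\<close>. Continuity of the exponential map then keeps the geodesic near \<open>m\<close>, and its
  velocity, in the parameter interval \<open>[-s,s]\<close>, is at most a constant multiple of \<open>|w(s)|/s\<close> and hence
  bounded. The geodesic equation bounds the acceleration too, so the velocity differs by \<open>O(s)\<close> from the
  slope of the chord, and that slope tends to \<open>h\<close>.\<close>

lemma geodesic_family_through_chords:
  fixes \<Gamma> :: "'a::euclidean_space tensor12"
  assumes "open \<Omega>" and T: "smooth_sym_tensor \<Omega> \<Gamma>" and "m \<in> \<Omega>"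
    and lm: "local_midpoint_map \<Omega> \<Gamma> W M"
    and \<alpha>: "(\<alpha> has_vector_derivative h) (at 0)" "\<alpha> 0 = m"
  obtains \<beta> \<beta>' where "geodesic_family \<Omega> \<Gamma> m h \<beta> \<beta>'"
    "\<forall>\<^sub>F s in at_right 0. \<beta> s s = \<alpha> s \<and> \<beta> s (-s) = \<alpha> (-s) \<and> \<beta> s 0 = M (\<alpha> (-s)) (\<alpha> s)"
proof -
  let ?F = "\<lambda>(P, v). (P, geod_exp \<Omega> \<Gamma> P v)"
  obtain U where W: "open W" "diag \<Omega> \<subseteq> W" and U: "open U" "\<Omega> \<times> {0} \<subseteq> U" "U \<subseteq> exp_dom \<Omega> \<Gamma>"
    and F: "diffeomorphism_on U W ?F"
    and M: "\<forall>(P, Q) \<in> W. M P Q =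
      geod_exp \<Omega> \<Gamma> P ((1/2) *\<^sub>R inv_into {v. (P, v) \<in> U} (geod_exp \<Omega> \<Gamma> P) Q)"
    using lm unfolding local_midpoint_map_def by blast
  have bij: "bij_betw ?F U W" and smF: "smooth_on U ?F" and smG: "smooth_on W (inv_into U ?F)"
    using F by (auto simp: diffeomorphism_on_def)
  have m0: "(m, 0) \<in> U" using U(2) assms(3) by auto
  have Fm: "?F (m, 0) = (m, m)" using geod_exp_zero[OF assms(1-3)] by simp
  have mm: "(m, m) \<in> W" using W(2) assms(3) by (auto simp: diag_def)
  define G where "G = inv_into U ?F"
  have Gmm: "G (m, m) = (m, 0)"
    unfolding G_def Fm[symmetric] using bij m0 by (intro inv_into_f_f) (auto simp: bij_betw_def)
  define c where "c s = (\<alpha> (-s), \<alpha> s)" for s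
  define w where "w s = snd (G (c s))" for s
  have pos: "\<forall>\<^sub>F s in at_right 0. (0::real) < s" by (rule eventually_at_right_less)
  have neg: "((\<lambda>s::real. - s) has_vector_derivative -1) (at 0)"
    by (auto intro!: derivative_eq_intros)
  have \<alpha>m: "((\<lambda>s. \<alpha> (-s)) has_vector_derivative - h) (at 0)"
    using vector_diff_chain_at[OF neg, of \<alpha> h] \<alpha> by (simp add: o_def)
  have dc: "(c has_vector_derivative (- h, h)) (at 0)"
    unfolding c_def by (intro has_vector_derivative_Pair \<alpha>m \<alpha>)
  have c0: "c 0 = (m, m)" by (simp add: c_def \<alpha>)
  let ?DG = "frechet_derivative G (at (m, m))"
  have "(G has_derivative ?DG) (at (c 0))"
    using smooth_on_has_derivative[OF smG mm] unfolding c0 G_def .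
  note DGc = has_derivative_compose[OF dc[unfolded has_vector_derivative_def] this]
  have linG: "linear ?DG"
    using smooth_on_has_derivative[OF smG mm] has_derivative_linear unfolding G_def by blast
  define k where "k = snd (?DG (- h, h))"
  have dw: "(w has_vector_derivative k) (at 0)"
    using bounded_linear.has_derivative[OF bounded_linear_snd DGc]
    unfolding w_def has_vector_derivative_def k_def linear_cmul[OF linG] snd_scaleR .
  have w0: "w 0 = 0" by (simp add: w_def c0 Gmm)
  have cont0: "(f \<longlongrightarrow> f 0) (at_right 0)" if "(f has_vector_derivative f') (at 0)" for f f' 
    using has_vector_derivative_continuous[OF that] unfolding isCont_def
    by (rule tendsto_within_subset) simp
  have lw: "(w \<longlongrightarrow> 0) (at_right 0)" and lc: "(c \<longlongrightarrow> (m, m)) (at_right 0)"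
    and l\<alpha>m: "((\<lambda>s. \<alpha> (-s)) \<longlongrightarrow> m) (at_right 0)"
    using cont0[OF dw] cont0[OF dc] cont0[OF \<alpha>m] by (simp_all add: w0 c0 \<alpha>)
  have "((\<lambda>s. norm ((1 / s) *\<^sub>R (w s - w 0))) \<longlongrightarrow> norm k) (at_right 0)"
    by (intro tendsto_norm vector_derivative_quotient_limit dw)
  then have "\<forall>\<^sub>F s in at_right 0. norm ((1 / s) *\<^sub>R (w s - w 0)) < norm k + 1"
    by (rule order_tendstoD) simp
  then have wbound: "\<forall>\<^sub>F s in at_right 0. norm (w s) \<le> (norm k + 1) * s"
    using pos by eventually_elim (simp add: w0 field_simps)
  have Wc: "\<forall>\<^sub>F s in at_right 0. c s \<in> W"
    using topological_tendstoD[OF lc W(1) mm] .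
  have inU: "\<forall>\<^sub>F s in at_right 0. (\<alpha> (-s), w s) \<in> U \<and> geod_exp \<Omega> \<Gamma> (\<alpha> (-s)) (w s) = \<alpha> s"
    using Wc
  proof eventually_elim
    fix s assume "c s \<in> W"
    then have "G (c s) \<in> U" "?F (G (c s)) = c s"
      using bij inv_into_into[of "c s" ?F U] f_inv_into_f[of "c s" ?F U]
      by (auto simp: G_def bij_betw_def)
    then show "(\<alpha> (-s), w s) \<in> U \<and> geod_exp \<Omega> \<Gamma> (\<alpha> (-s)) (w s) = \<alpha> s"
      unfolding w_def c_def by (cases "G (\<alpha> (-s), \<alpha> s)") simp
  qed
  have "\<forall>P v. \<exists>J \<gamma> \<gamma>'. (P, v) \<in> U \<longrightarrow> open J \<and> is_interval J \<and> {0..1} \<subseteq> J \<and> geodesic_on \<Omega> \<Gamma> J \<gamma> \<gamma>' \<and>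
      \<gamma> 0 = P \<and> \<gamma>' 0 = v"
  proof (intro allI)
    fix P v
    have "exp_rel \<Omega> \<Gamma> P v Q \<Longrightarrow> \<exists>J \<gamma> \<gamma>'. open J \<and> is_interval J \<and> {0..1} \<subseteq> J \<and>
        geodesic_on \<Omega> \<Gamma> J \<gamma> \<gamma>' \<and> \<gamma> 0 = P \<and> \<gamma>' 0 = v" for Q
      unfolding exp_rel_def by blast
    moreover have "\<exists>Q. exp_rel \<Omega> \<Gamma> P v Q" if "(P, v) \<in> U"
      using that U(3) by (auto simp: exp_dom_def)
    ultimately show "\<exists>J \<gamma> \<gamma>'. (P, v) \<in> U \<longrightarrow> open J \<and> is_interval J \<and> {0..1} \<subseteq> J \<and>
        geodesic_on \<Omega> \<Gamma> J \<gamma> \<gamma>' \<and> \<gamma> 0 = P \<and> \<gamma>' 0 = v"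
      by blast
  qed
  then obtain J \<gamma> \<gamma>' where J: "\<And>P v. (P, v) \<in> U \<Longrightarrow> open (J P v)"
      "\<And>P v. (P, v) \<in> U \<Longrightarrow> is_interval (J P v)" "\<And>P v. (P, v) \<in> U \<Longrightarrow> {0..1} \<subseteq> J P v"
    and \<gamma>: "\<And>P v. (P, v) \<in> U \<Longrightarrow> geodesic_on \<Omega> \<Gamma> (J P v) (\<gamma> P v) (\<gamma>' P v)"
      "\<And>P v. (P, v) \<in> U \<Longrightarrow> \<gamma> P v 0 = P" "\<And>P v. (P, v) \<in> U \<Longrightarrow> \<gamma>' P v 0 = v"
    unfolding choice_iff by blast
  have exp_\<gamma>: "geod_exp \<Omega> \<Gamma> P (\<tau> *\<^sub>R v) = \<gamma> P v \<tau>" if "(P, v) \<in> U" "\<tau> \<in> {0..1}" for P v \<tau>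
  proof -
    have J01: "0 \<in> J P v" "\<tau> \<in> J P v" using J(3)[OF that(1)] that(2) by auto
    show ?thesis
      using geod_exp_along_geodesic[OF assms(1) T J(1,2)[OF that(1)] \<gamma>(1)[OF that(1)] J01]
        \<gamma>(2,3)[OF that(1)] by simp
  qed
  \<comment> \<open>The affine change of parameter takes \<open>[-s,s]\<close> to \<open>[0,1]\<close> and \<open>0\<close> to the midpoint parameter.\<close>
  define \<beta> where "\<beta> s t = \<gamma> (\<alpha> (-s)) (w s) (1 / 2 + (1 / (2 * s)) * t)" for s t
  define \<beta>' where "\<beta>' s t = (1 / (2 * s)) *\<^sub>R \<gamma>' (\<alpha> (-s)) (w s) (1 / 2 + (1 / (2 * s)) * t)" for s t
  have unit: "1 / 2 + (1 / (2 * s)) * t \<in> {0..1}" if "0 < s" "t \<in> {-s..s}" for s t :: real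
    using that by (auto simp: field_simps)
  have ends: "\<forall>\<^sub>F s in at_right 0. \<beta> s s = \<alpha> s \<and> \<beta> s (-s) = \<alpha> (-s) \<and> \<beta> s 0 = M (\<alpha> (-s)) (\<alpha> s)"
    using inU pos
  proof eventually_elim
    fix s :: real
    assume s: "(\<alpha> (-s), w s) \<in> U \<and> geod_exp \<Omega> \<Gamma> (\<alpha> (-s)) (w s) = \<alpha> s" "0 < s"
    then have in_U: "(\<alpha> (-s), w s) \<in> U" by simp
    have "\<gamma> (\<alpha> (-s)) (w s) 1 = \<alpha> s"
      using exp_\<gamma>[OF in_U, of 1] s(1) by simp
    moreover have "\<gamma> (\<alpha> (-s)) (w s) (1 / 2) = M (\<alpha> (-s)) (\<alpha> s)"
      using exp_\<gamma>[OF in_U, of "1 / 2"] midpoint_of_geod_exp[OF F M in_U] s(1) by simp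
    ultimately show "\<beta> s s = \<alpha> s \<and> \<beta> s (-s) = \<alpha> (-s) \<and> \<beta> s 0 = M (\<alpha> (-s)) (\<alpha> s)"
      using \<gamma>(2)[OF in_U] s(2) by (simp add: \<beta>_def)
  qed
  have geo: "\<forall>\<^sub>F s in at_right 0. geodesic_on \<Omega> \<Gamma> {-s..s} (\<beta> s) (\<beta>' s)"
    using inU pos
  proof eventually_elim
    fix s :: real
    assume s: "(\<alpha> (-s), w s) \<in> U \<and> geod_exp \<Omega> \<Gamma> (\<alpha> (-s)) (w s) = \<alpha> s" "0 < s"
    then have "{-s..s} \<subseteq> {t. 1 / 2 + (1 / (2 * s)) * t \<in> J (\<alpha> (-s)) (w s)}"
      using unit J(3) by blast
    then show "geodesic_on \<Omega> \<Gamma> {-s..s} (\<beta> s) (\<beta>' s)"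
      unfolding \<beta>_def \<beta>'_def
      using geodesic_on_subset[OF geodesic_on_affine[OF T \<gamma>(1)]] s(1) by blast
  qed
  have position: "\<forall>\<^sub>F s in at_right 0. \<forall>t\<in>{-s..s}. dist (\<beta> s t) m < e" if "e > 0" for e
  proof -
    have "isCont ?F (m, 0)"
      using has_derivative_continuous[OF smooth_on_has_derivative[OF smF m0]] .
    then have "isCont (\<lambda>z. snd (?F z)) (m, 0)" by (rule isCont_snd)
    then have "\<exists>\<rho>>0. \<forall>z. dist z (m, 0) < \<rho> \<longrightarrow> dist (snd (?F z)) (snd (?F (m, 0))) < e"
      using that unfolding continuous_at_eps_delta by blast
    then obtain \<rho> where \<rho>: "\<rho> > 0" "\<And>z. dist z (m, 0) < \<rho> \<Longrightarrow> dist (snd (?F z)) m < e"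
      unfolding Fm snd_conv by blast
    have "((\<lambda>s. dist (\<alpha> (-s)) m + norm (w s)) \<longlongrightarrow> dist m m + norm (0::'a)) (at_right 0)"
      by (intro tendsto_intros l\<alpha>m lw)
    then have "\<forall>\<^sub>F s in at_right 0. dist (\<alpha> (-s)) m + norm (w s) < \<rho>"
      using \<rho>(1) by (intro order_tendstoD) auto
    then show ?thesis using inU pos
    proof (eventually_elim, intro ballI)
      fix s t :: real assume small: "dist (\<alpha> (-s)) m + norm (w s) < \<rho>"
        and in_U: "(\<alpha> (-s), w s) \<in> U \<and> geod_exp \<Omega> \<Gamma> (\<alpha> (-s)) (w s) = \<alpha> s"
        and s: "0 < s" and t: "t \<in> {-s..s}"
      define \<tau> where "\<tau> = 1 / 2 + (1 / (2 * s)) * t"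
      have \<tau>: "\<tau> \<in> {0..1}" unfolding \<tau>_def using unit[OF s t] .
      then have "norm (\<tau> *\<^sub>R w s) \<le> norm (w s)" by (simp add: mult_left_le_one_le)
      then have "dist (\<alpha> (-s), \<tau> *\<^sub>R w s) (m, 0) < \<rho>"
        using dist_Pair_zero_le[of "\<alpha> (-s)" "\<tau> *\<^sub>R w s" m] small by linarith
      then have "dist (geod_exp \<Omega> \<Gamma> (\<alpha> (-s)) (\<tau> *\<^sub>R w s)) m < e" using \<rho>(2) by fastforce
      then show "dist (\<beta> s t) m < e"
        using exp_\<gamma>[OF _ \<tau>, of "\<alpha> (-s)" "w s"] in_U by (simp add: \<beta>_def \<tau>_def)
    qed
  qed
  obtain C \<rho> where C: "C \<ge> 0" "\<rho> > 0"
    "\<And>J \<gamma> \<gamma>' \<tau>. \<lbrakk>open J; is_interval J; {0..1} \<subseteq> J; geodesic_on \<Omega> \<Gamma> J \<gamma> \<gamma>';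
        dist (\<gamma> 0) m < \<rho>; norm (\<gamma>' 0) < \<rho>; \<tau> \<in> {0..1}\<rbrakk> \<Longrightarrow> norm (\<gamma>' \<tau>) \<le> C * norm (\<gamma>' 0)"
    using exp_velocity_bound[OF assms(1) T U(1) m0 smF] by blast
  \<comment> \<open>The factor \<open>1/2\<close> is due to the length \<open>2s\<close> of the parameter interval.\<close>
  define B where "B = C * (norm k + 1) / 2"
  have velocity: "\<forall>\<^sub>F s in at_right 0. \<forall>t\<in>{-s..s}. norm (\<beta>' s t) \<le> B"
  proof -
    have "\<forall>\<^sub>F s in at_right 0. dist (\<alpha> (-s)) m < \<rho>" "\<forall>\<^sub>F s in at_right 0. norm (w s) < \<rho>"
      using tendstoD[OF l\<alpha>m C(2)] tendstoD[OF lw C(2)] by (simp_all add: dist_norm)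
    then show ?thesis using inU pos wbound
    proof (eventually_elim, intro ballI)
      fix s t :: real assume small: "dist (\<alpha> (-s)) m < \<rho>" "norm (w s) < \<rho>"
        and "(\<alpha> (-s), w s) \<in> U \<and> geod_exp \<Omega> \<Gamma> (\<alpha> (-s)) (w s) = \<alpha> s"
        and s: "0 < s" and t: "t \<in> {-s..s}" and wb: "norm (w s) \<le> (norm k + 1) * s"
      then have in_U: "(\<alpha> (-s), w s) \<in> U" by simp
      let ?v = "\<gamma>' (\<alpha> (-s)) (w s) (1 / 2 + (1 / (2 * s)) * t)"
      have "norm ?v \<le> C * norm (w s)"
        using C(3)[OF J[OF in_U] \<gamma>(1)[OF in_U] _ _ unit[OF s t]] small \<gamma>(2,3)[OF in_U] by simp
      also have "\<dots> \<le> C * ((norm k + 1) * s)" using wb C(1) by (rule mult_left_mono)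
      finally have "(1 / (2 * s)) * norm ?v \<le> (1 / (2 * s)) * (C * ((norm k + 1) * s))"
        using s by (intro mult_left_mono) auto
      also have "\<dots> = B" using s by (simp add: B_def)
      finally show "norm (\<beta>' s t) \<le> B" using s by (simp add: \<beta>'_def)
    qed
  qed
  obtain e0 K where K: "e0 > 0" "0 \<le> K"
    "\<And>x v. dist x m < e0 \<Longrightarrow> norm v \<le> B \<Longrightarrow> norm (\<Gamma> x v v) \<le> K"
    using tensor_locally_bounded[OF assms(1-3), of B] by metis
  have "((\<lambda>s. \<alpha> s - \<alpha> (-s)) has_vector_derivative h - (- h)) (at 0)"
    by (intro has_vector_derivative_diff \<alpha> \<alpha>m)
  from vector_derivative_quotient_limit[OF this]
  have "((\<lambda>s. (1 / 2) *\<^sub>R ((1 / s) *\<^sub>R (\<alpha> s - \<alpha> (-s)))) \<longlongrightarrow> (1 / 2) *\<^sub>R (h + h)) (at_right 0)"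
    by (intro tendsto_scaleR tendsto_const) simp
  then have chord: "((\<lambda>s. (1 / (2 * s)) *\<^sub>R (\<alpha> s - \<alpha> (-s))) \<longlongrightarrow> h) (at_right 0)"
    by (simp add: scaleR_half_double)
  have "\<forall>\<^sub>F s in at_right 0. \<forall>t\<in>{-s..s}. dist (\<beta> s t) m < e \<and> dist (\<beta>' s t) h < e" if "e > 0" for e
  proof -
    have "((\<lambda>s. 2 * K * s + dist ((1 / (2 * s)) *\<^sub>R (\<alpha> s - \<alpha> (-s))) h) \<longlongrightarrow> 2 * K * 0 + dist h h) (at_right 0)"
      by (intro tendsto_intros chord)
    then have "\<forall>\<^sub>F s in at_right 0. 2 * K * s + dist ((1 / (2 * s)) *\<^sub>R (\<alpha> s - \<alpha> (-s))) h < e"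
      using that by (intro order_tendstoD) auto
    then show ?thesis
      using position[OF that] position[OF K(1)] velocity geo ends pos
    proof (eventually_elim, intro ballI)
      fix s t :: real
      assume small: "2 * K * s + dist ((1 / (2 * s)) *\<^sub>R (\<alpha> s - \<alpha> (-s))) h < e"
        and p: "\<forall>t\<in>{-s..s}. dist (\<beta> s t) m < e" "\<forall>t\<in>{-s..s}. dist (\<beta> s t) m < e0"
        and v: "\<forall>t\<in>{-s..s}. norm (\<beta>' s t) \<le> B"
        and g: "geodesic_on \<Omega> \<Gamma> {-s..s} (\<beta> s) (\<beta>' s)"
        and e: "\<beta> s s = \<alpha> s \<and> \<beta> s (-s) = \<alpha> (-s) \<and> \<beta> s 0 = M (\<alpha> (-s)) (\<alpha> s)"
        and s: "0 < s" and t: "t \<in> {-s..s}"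
      have "norm (\<beta>' s t - (1 / (2 * s)) *\<^sub>R (\<beta> s s - \<beta> s (-s))) \<le> 2 * K * s"
        by (rule symmetric_interval_vector_derivative_norm_bound[OF s t K(2) geodesic_onD(2,3)[OF g]])
          (use K(3) p(2) v in auto)
      then have "dist (\<beta>' s t) ((1 / (2 * s)) *\<^sub>R (\<alpha> s - \<alpha> (-s))) \<le> 2 * K * s"
        using e by (simp add: dist_norm)
      then have "dist (\<beta>' s t) h < e"
        using dist_triangle[of "\<beta>' s t" h "(1 / (2 * s)) *\<^sub>R (\<alpha> s - \<alpha> (-s))"] small by linarith
      then show "dist (\<beta> s t) m < e \<and> dist (\<beta>' s t) h < e" using p(1) t by blast
    qed
  qed
  then have "geodesic_family \<Omega> \<Gamma> m h \<beta> \<beta>'"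
    unfolding geodesic_family_def using geo by blast
  then show ?thesis using that ends by blast
qed

lemma geodesic_family_const:
  assumes "r > 0" and g: "geodesic_on \<Omega> \<Gamma> {-r<..<r} \<alpha> \<alpha>'" and 0: "\<alpha> 0 = m" "\<alpha>' 0 = h"
  shows "geodesic_family \<Omega> \<Gamma> m h (\<lambda>_. \<alpha>) (\<lambda>_. \<alpha>')"
  unfolding geodesic_family_def
proof (intro conjI allI impI)
  have small: "\<forall>\<^sub>F s in at_right 0. s < d" if "d > 0" for d :: real
    using order_tendstoD(2)[OF tendsto_ident_at that] .
  show "\<forall>\<^sub>F s in at_right 0. geodesic_on \<Omega> \<Gamma> {-s..s} \<alpha> \<alpha>'"
    using small[OF assms(1)] by eventually_elim (auto intro!: geodesic_on_subset[OF g])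
  fix e :: real assume "e > 0"
  have "isCont \<alpha> 0" "isCont \<alpha>' 0"
    using geodesic_onD(2,3)[OF g, of 0] assms(1) has_vector_derivative_continuous by auto
  then have "\<exists>d>0. \<forall>t. dist t 0 < d \<longrightarrow> dist (\<alpha> t) m < e" "\<exists>d>0. \<forall>t. dist t 0 < d \<longrightarrow> dist (\<alpha>' t) h < e"
    using \<open>e > 0\<close> unfolding continuous_at_eps_delta 0 by blast+
  then obtain d1 d2 where d: "d1 > 0" "\<And>t. dist t 0 < d1 \<Longrightarrow> dist (\<alpha> t) m < e"
    "d2 > 0" "\<And>t. dist t 0 < d2 \<Longrightarrow> dist (\<alpha>' t) h < e"
    by blast
  show "\<forall>\<^sub>F s in at_right 0. \<forall>t\<in>{-s..s}. dist (\<alpha> t) m < e \<and> dist (\<alpha>' t) h < e"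
    using small[OF d(1)] small[OF d(3)]
    by eventually_elim (auto intro!: d(2,4) simp: dist_real_def)
qed

text \<open>Starting from one geodesic \<open>\<alpha>\<close> of the first connection through \<open>m\<close>, the chord from \<open>\<alpha>(-s)\<close> to \<open>\<alpha>(s)\<close> has
  the fixed first midpoint \<open>\<alpha>(0) = m\<close>. Only the second family has to be constructed.\<close>

lemma matched_families_exist:
  fixes \<Gamma>1 \<Gamma>2 :: "'a::euclidean_space tensor12"
  assumes "open \<Omega>" and T: "smooth_sym_tensor \<Omega> \<Gamma>1" "smooth_sym_tensor \<Omega> \<Gamma>2"
    and lm1: "local_midpoint_map \<Omega> \<Gamma>1 W1 A1" and lm2: "local_midpoint_map \<Omega> \<Gamma>2 W2 A2"
    and N: "open N" "diag \<Omega> \<subseteq> N" "\<forall>(P, Q) \<in> N. A1 P Q + A2 P Q = P + Q" and m: "m \<in> \<Omega>"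
  obtains \<alpha> \<alpha>' \<beta> \<beta>' where "geodesic_family \<Omega> \<Gamma>1 m h (\<lambda>_. \<alpha>) (\<lambda>_. \<alpha>')" "\<alpha> 0 = m" "\<alpha>' 0 = h"
    "geodesic_family \<Omega> \<Gamma>2 m h \<beta> \<beta>'"
    "\<forall>\<^sub>F s in at_right 0. \<alpha> s = \<beta> s s \<and> \<alpha> (-s) = \<beta> s (-s) \<and> \<alpha> 0 + \<beta> s 0 = \<alpha> s + \<alpha> (-s)"
proof -
  obtain U where U: "open U" "\<Omega> \<times> {0} \<subseteq> U" "U \<subseteq> exp_dom \<Omega> \<Gamma>1"
    and F: "diffeomorphism_on U W1 (\<lambda>(P, v). (P, geod_exp \<Omega> \<Gamma>1 P v))"
    and M: "\<forall>(P, Q) \<in> W1. A1 P Q =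
      geod_exp \<Omega> \<Gamma>1 P ((1/2) *\<^sub>R inv_into {v. (P, v) \<in> U} (geod_exp \<Omega> \<Gamma>1 P) Q)"
    using lm1 unfolding local_midpoint_map_def by blast
  have m0: "(m, 0) \<in> U" using U(2) m by auto
  obtain r \<alpha> \<alpha>' where r: "r > 0" and g: "geodesic_on \<Omega> \<Gamma>1 {-r<..<r} \<alpha> \<alpha>'" and \<alpha>0: "\<alpha> 0 = m" "\<alpha>' 0 = h"
    using geodesic_through[OF T(1) U(1) m0 U(3)] .
  have fam1: "geodesic_family \<Omega> \<Gamma>1 m h (\<lambda>_. \<alpha>) (\<lambda>_. \<alpha>')"
    by (rule geodesic_family_const[OF r g \<alpha>0])
  have d\<alpha>: "(\<alpha> has_vector_derivative h) (at 0)"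
    using geodesic_onD(2)[OF g, of 0] r \<alpha>0 by simp
  obtain \<beta> \<beta>' where fam2: "geodesic_family \<Omega> \<Gamma>2 m h \<beta> \<beta>'"
    and ends: "\<forall>\<^sub>F s in at_right 0. \<beta> s s = \<alpha> s \<and> \<beta> s (-s) = \<alpha> (-s) \<and> \<beta> s 0 = A2 (\<alpha> (-s)) (\<alpha> s)"
    using geodesic_family_through_chords[OF assms(1) T(2) m lm2 d\<alpha> \<alpha>0(1)] by blast
  have pos: "\<forall>\<^sub>F s in at_right 0. (0::real) < s" by (rule eventually_at_right_less)
  have r': "\<forall>\<^sub>F s in at_right 0. s < r" using order_tendstoD(2)[OF tendsto_ident_at r] .
  have "\<forall>\<^sub>F s in at_right 0. (s::real) \<in> {-s..s}" "\<forall>\<^sub>F s in at_right 0. -(s::real) \<in> {-s..s}"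
    using pos by (eventually_elim, simp)+
  note lim = geodesic_family_tendsto[OF fam1 this(1)] geodesic_family_tendsto[OF fam1 this(2)]
  have "((\<lambda>s. (\<alpha> (-s), \<alpha> s)) \<longlongrightarrow> (m, m)) (at_right 0)"
    by (intro tendsto_Pair lim)
  then have inN: "\<forall>\<^sub>F s in at_right 0. (\<alpha> (-s), \<alpha> s) \<in> N"
    using N(2) m by (intro topological_tendstoD[OF _ N(1)]) (auto simp: diag_def)
  have "((\<lambda>s. (\<alpha> (-s), (2 * s) *\<^sub>R \<alpha>' (-s))) \<longlongrightarrow> (m, (2 * 0) *\<^sub>R h)) (at_right 0)"
    by (intro tendsto_intros lim)
  then have inU: "\<forall>\<^sub>F s in at_right 0. (\<alpha> (-s), (2 * s) *\<^sub>R \<alpha>' (-s)) \<in> U"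
    using topological_tendstoD[OF _ U(1)] m0 by simp
  have "\<forall>\<^sub>F s in at_right 0. \<alpha> s = \<beta> s s \<and> \<alpha> (-s) = \<beta> s (-s) \<and> \<alpha> 0 + \<beta> s 0 = \<alpha> s + \<alpha> (-s)"
    using inN inU ends pos r'
  proof eventually_elim
    fix s :: real
    assume inN: "(\<alpha> (-s), \<alpha> s) \<in> N" and inU: "(\<alpha> (-s), (2 * s) *\<^sub>R \<alpha>' (-s)) \<in> U"
      and ends: "\<beta> s s = \<alpha> s \<and> \<beta> s (-s) = \<alpha> (-s) \<and> \<beta> s 0 = A2 (\<alpha> (-s)) (\<alpha> s)"
      and s: "0 < s" "s < r"
    have along: "geod_exp \<Omega> \<Gamma>1 (\<alpha> (-s)) ((q - (-s)) *\<^sub>R \<alpha>' (-s)) = \<alpha> q" if "q \<in> {-r<..<r}" for q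
      by (rule geod_exp_along_geodesic[OF assms(1) T(1) _ _ g _ that])
        (use s in \<open>auto simp: is_interval_1\<close>)
    have "geod_exp \<Omega> \<Gamma>1 (\<alpha> (-s)) ((2 * s) *\<^sub>R \<alpha>' (-s)) = \<alpha> s"
      using along[of s] s by simp
    moreover have "geod_exp \<Omega> \<Gamma>1 (\<alpha> (-s)) ((1 / 2) *\<^sub>R (2 * s) *\<^sub>R \<alpha>' (-s)) = \<alpha> 0"
      using along[of 0] r by simp
    ultimately have "A1 (\<alpha> (-s)) (\<alpha> s) = \<alpha> 0"
      using midpoint_of_geod_exp[OF F M inU] by simp
    moreover have "A1 (\<alpha> (-s)) (\<alpha> s) + A2 (\<alpha> (-s)) (\<alpha> s) = \<alpha> (-s) + \<alpha> s"
      using N(3) inN by blast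
    ultimately show "\<alpha> s = \<beta> s s \<and> \<alpha> (-s) = \<beta> s (-s) \<and> \<alpha> 0 + \<beta> s 0 = \<alpha> s + \<alpha> (-s)"
      using ends by (simp add: add.commute)
  qed
  then show ?thesis using that fam1 fam2 \<alpha>0 by blast
qed

section \<open>Opposite connections and the obstruction\<close>

theorem theorem9p2:
  fixes \<Omega> :: "(real ^ 'd) set"
    and \<Gamma>1 \<Gamma>2 :: "(real ^ 'd) tensor12"
    and A1 A2 :: "real ^ 'd \<Rightarrow> real ^ 'd \<Rightarrow> real ^ 'd"
    and W1 W2 N :: "((real ^ 'd) \<times> (real ^ 'd)) set"
  assumes "open \<Omega>" and "connected \<Omega>"
    and "smooth_sym_tensor \<Omega> \<Gamma>1" and "smooth_sym_tensor \<Omega> \<Gamma>2"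
    and "local_midpoint_map \<Omega> \<Gamma>1 W1 A1" and "local_midpoint_map \<Omega> \<Gamma>2 W2 A2"
    and "open N" and "diag \<Omega> \<subseteq> N" and "N \<subseteq> W1 \<inter> W2"
    and "\<forall>(P, Q) \<in> N. A1 P Q + A2 P Q = P + Q"
  shows "(\<forall>x\<in>\<Omega>. \<forall>u v. \<Gamma>2 x u v = - \<Gamma>1 x u v) \<and>
         (\<forall>x\<in>\<Omega>. \<forall>h. obstruction \<Gamma>1 x h = 0)"
proof -
  note families = matched_families_exist[OF assms(1,3-8,10)]
  have quad: "\<Gamma>1 x h h + \<Gamma>2 x h h = 0" if x: "x \<in> \<Omega>" for x h
  proof -
    obtain \<alpha> \<alpha>' \<beta> \<beta>' where "geodesic_family \<Omega> \<Gamma>1 x h (\<lambda>_. \<alpha>) (\<lambda>_. \<alpha>')" "\<alpha> 0 = x" "\<alpha>' 0 = h"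
      "geodesic_family \<Omega> \<Gamma>2 x h \<beta> \<beta>'"
      "\<forall>\<^sub>F s in at_right 0. \<alpha> s = \<beta> s s \<and> \<alpha> (-s) = \<beta> s (-s) \<and> \<alpha> 0 + \<beta> s 0 = \<alpha> s + \<alpha> (-s)"
      using families[OF x] .
    then show ?thesis
      using matched_families_limits(1)[OF assms(1,3,4) x] by blast
  qed
  have neg: "\<Gamma>2 x u v = - \<Gamma>1 x u v" if x: "x \<in> \<Omega>" for x u v
  proof -
    have lin: "linear (\<lambda>u. \<Gamma>1 x u v)" "linear (\<Gamma>1 x u)" "linear (\<lambda>u. \<Gamma>2 x u v)" "linear (\<Gamma>2 x u)" for u v
      using smooth_sym_tensor_bilinear[OF assms(3) x] smooth_sym_tensor_bilinear[OF assms(4) x]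
      by (auto simp: bilinear_def)
    define S where "S = \<Gamma>1 x u v + \<Gamma>2 x u v"
    have "(\<Gamma>1 x u u + \<Gamma>2 x u u) + (\<Gamma>1 x v v + \<Gamma>2 x v v) + (S + S) =
        \<Gamma>1 x (u + v) (u + v) + \<Gamma>2 x (u + v) (u + v)"
      unfolding S_def
      by (simp add: linear_add[OF lin(1)] linear_add[OF lin(2)] linear_add[OF lin(3)]
          linear_add[OF lin(4)] smooth_sym_tensor_sym[OF assms(3) x, of v u]
          smooth_sym_tensor_sym[OF assms(4) x, of v u])
    then have "S + S = 0" unfolding quad[OF x] by simp
    then have "2 *\<^sub>R S = 0" by (simp only: scaleR_2)
    then have "S = 0" by simp
    then show ?thesis unfolding S_def by (simp add: add_eq_0_iff)
  qed
  have "obstruction \<Gamma>1 x h = 0" if x: "x \<in> \<Omega>" for x h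
  proof -
    obtain \<alpha> \<alpha>' \<beta> \<beta>' where "geodesic_family \<Omega> \<Gamma>1 x h (\<lambda>_. \<alpha>) (\<lambda>_. \<alpha>')" "\<alpha> 0 = x" "\<alpha>' 0 = h"
      "geodesic_family \<Omega> \<Gamma>2 x h \<beta> \<beta>'"
      "\<forall>\<^sub>F s in at_right 0. \<alpha> s = \<beta> s s \<and> \<alpha> (-s) = \<beta> s (-s) \<and> \<alpha> 0 + \<beta> s 0 = \<alpha> s + \<alpha> (-s)"
      using families[OF x] .
    then show ?thesis
      using obstruction_of_matched_families[OF assms(1,3,4) x, of h "\<lambda>_. \<alpha>" "\<lambda>_. \<alpha>'" \<beta> \<beta>'] neg
      by blast
  qed
  with neg show ?thesis by blast
qed

end
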